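(* Let $b\ge2$ be an integer, $\gamma\in(0,1)$, and let $\phi:\mathbb{R}\to\mathbb{R}$ be a $\mathbb{Z}$-periodic Lipschitz function. Then (1) $\omega$ is exact dimensional; (2) there is a constant $\alpha\in[0,1]$ such that for Lebesgue-a.e. $x\in[0,1]$, $m_x$ is exact dimensional and $\dim(m_x)=\alpha$; (3) $\dim(\omega)=1+\alpha$.
   Context: $\Lambda=\{0,\dots,b-1\}$, $\Sigma=\Lambda^{\mathbb{Z}_+}$, $\nu$ the uniform probability on $\Lambda$. For $\mathbf{j}\in\Sigma$ and $x\in[0,1]$, $S(x,\mathbf{j})=\sum_{n\ge1}\gamma^{n-1}\phi\big(\frac{x+j_1+j_2b+\cdots+j_nb^{n-1}}{b^n}\big)$, and $m_x$ is the image of $\nu^{\mathbb{Z}_+}$ under $\mathbf{j}\mapsto S(x,\mathbf{j})$. $\omega$ is the SRB measure of $T(x,y)=(bx\bmod1,\gamma y+\phi(x))$ on $[0,1)\times\mathbb{R}$, i.e. the ergodic probability measure such that Lebesgue-a.e. point $z$ has $\frac1n\sum_{k<n}\delta_{T^kz}\to\omega$ weakly; equivalently $\omega=\int_{[0,1)}\delta_x\times m_x\,dx$. A probability measure $\mu$ is exact dimensional if for some $\beta$, $\lim_{r\to0}\log\mu(B(z,r))/\log r=\beta$ for $\mu$-a.e. $z$; then $\dim(\mu)=\beta$. *)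

theory Defs
  imports "HOL-Probability.Probability"
begin

text \<open>Digit sequences j = (j_1, j_2, ...) are represented as functions nat => nat,
  with j_k stored at index k-1. The Bernoulli measure nu^{Z+} is the infinite
  product of uniform measures on {0..<b}.\<close>

definition digit_measure :: "nat \<Rightarrow> (nat \<Rightarrow> nat) measure" where
  "digit_measure b = PiM UNIV (\<lambda>_::nat. uniform_count_measure {0..<b})"

text \<open>S(x,j) = sum_{n>=1} gamma^(n-1) phi((x + j_1 + j_2 b + ... + j_n b^(n-1)) / b^n),
  written with n shifted by one.\<close>
definition S_fun :: "nat \<Rightarrow> real \<Rightarrow> (real \<Rightarrow> real) \<Rightarrow> real \<Rightarrow> (nat \<Rightarrow> nat) \<Rightarrow> real" where
  "S_fun b \<gamma> \<phi> x j =
     (\<Sum>n. \<gamma> ^ n * \<phi> ((x + (\<Sum>k\<le>n. real (j k) * real b ^ k)) / real b ^ (n + 1)))"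

definition m_meas :: "nat \<Rightarrow> real \<Rightarrow> (real \<Rightarrow> real) \<Rightarrow> real \<Rightarrow> real measure" where
  "m_meas b \<gamma> \<phi> x = distr (digit_measure b) borel (S_fun b \<gamma> \<phi> x)"

definition omega_meas :: "nat \<Rightarrow> real \<Rightarrow> (real \<Rightarrow> real) \<Rightarrow> (real \<times> real) measure" where
  "omega_meas b \<gamma> \<phi> = measure_of UNIV (sets borel)
     (\<lambda>A. \<integral>\<^sup>+ x. indicator {0..<1} x * emeasure (m_meas b \<gamma> \<phi> x) (Pair x -` A) \<partial>lborel)"

definition exact_dimensional :: "'a::metric_space measure \<Rightarrow> real \<Rightarrow> bool" where
  "exact_dimensional \<mu> \<beta> \<longleftrightarrow>
     (AE z in \<mu>. ((\<lambda>r. ln (measure \<mu> (ball z r)) / ln r) \<longlongrightarrow> \<beta>) (at_right 0))"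

end

theory Submission
  imports Defs "HOL-Real_Asymp.Real_Asymp"
begin

text \<open>
  The inverse baker's transformation \<open>T (x, j) = ((x + j\<^sub>1) / b, shift j)\<close> preserves Lebesgue measure times
  the Bernoulli measure and is ergodic, being a two-sided Bernoulli shift in disguise. From
  \<open>S (x, j) = \<phi> ((x + j\<^sub>1) / b) + \<gamma> * S (T (x, j))\<close> it follows that the mass that the cylinder of \<open>j\<^sub>1\<close>
  contributes to the ball of radius \<open>R * \<gamma>\<^sup>n\<close> around \<open>S (x, j)\<close> is \<open>1 / b\<close> times the \<open>m\<close>-mass of the ball
  of radius \<open>R * \<gamma>\<^sup>n\<^sup>-\<^sup>1\<close> at \<open>T (x, j)\<close>. Hence the logarithm of the mass of a ball is a sum, along the
  \<open>T\<close>-orbit, of logarithms of the conditional mass of the cylinder of \<open>j\<^sub>1\<close> in smaller and smaller balls.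
  These conditional masses converge almost everywhere by differentiation of measures on the line, with an
  integrable bound from the one-dimensional maximal inequality, so Maker's ergodic theorem gives the
  local dimension of \<open>m\<^sub>x\<close>. Finally, \<open>S\<close> is uniformly Lipschitz in \<open>x\<close>, so the \<open>\<omega>\<close>-mass of a ball of radius
  \<open>r\<close> around \<open>(x, y)\<close> is comparable to \<open>r\<close> times the \<open>m\<^sub>x\<close>-mass of a ball of comparable radius around \<open>y\<close>.
\<close>

section \<open>The ergodic theorems of Birkhoff and Maker\<close>

lemma tendsto_iff_dist_less_inverse_Suc:
  fixes f :: "'b \<Rightarrow> 'a::metric_space"
  shows "(f \<longlongrightarrow> l) F \<longleftrightarrow> (\<forall>k::nat. \<forall>\<^sub>F x in F. dist (f x) l < inverse (real (Suc k)))"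
proof
  assume near: "\<forall>k::nat. \<forall>\<^sub>F x in F. dist (f x) l < inverse (real (Suc k))"
  show "(f \<longlongrightarrow> l) F"
  proof (rule tendstoI)
    fix e :: real assume "0 < e"
    then obtain k where "inverse (real (Suc k)) < e" using reals_Archimedean by blast
    then show "\<forall>\<^sub>F x in F. dist (f x) l < e"
      using near[rule_format, of k] by (auto elim!: eventually_mono)
  qed
qed (simp add: tendstoD)

lemma SUP_tail_tendsto_0:
  fixes u :: "nat \<Rightarrow> real"
  assumes bdd: "bdd_above (range u)" and nonneg: "\<And>n. 0 \<le> u n" and lim: "u \<longlonglongrightarrow> 0"
  shows "(\<lambda>N. SUP n\<in>{N..}. u n) \<longlonglongrightarrow> 0"
proof (rule LIMSEQ_I)
  fix e :: real assume "0 < e"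
  then obtain N where N: "\<And>n. N \<le> n \<Longrightarrow> \<bar>u n\<bar> < e / 2"
    using LIMSEQ_D[OF lim, of "e / 2"] by auto
  have "norm ((SUP n\<in>{M..}. u n) - 0) < e" if "N \<le> M" for M
  proof -
    have "u n \<le> e / 2" if "M \<le> n" for n
      using N[of n] that \<open>N \<le> M\<close> by linarith
    then have "(SUP n\<in>{M..}. u n) \<le> e / 2" by (intro cSUP_least) auto
    moreover have "u M \<le> (SUP n\<in>{M..}. u n)"
      by (intro cSUP_upper bdd_above_mono[OF bdd]) auto
    ultimately show ?thesis using nonneg[of M] \<open>0 < e\<close> by simp
  qed
  then show "\<exists>N. \<forall>M\<ge>N. norm ((SUP n\<in>{M..}. u n) - 0) < e" by blast
qed

lemma
  fixes h :: "nat \<Rightarrow> 'a \<Rightarrow> real"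
  assumes [measurable]: "\<And>n. h n \<in> borel_measurable M" and G: "integrable M G"
    and nonneg: "\<And>n x. 0 \<le> h n x" and le_G: "\<And>n x. h n x \<le> G x"
  shows integrable_SUP_tail: "integrable M (\<lambda>x. SUP n\<in>{N..}. h n x)"
    and integral_SUP_tail_tendsto_0:
      "AE x in M. (\<lambda>n. h n x) \<longlonglongrightarrow> 0 \<Longrightarrow> (\<lambda>N. \<integral>x. (SUP n\<in>{N..}. h n x) \<partial>M) \<longlonglongrightarrow> 0"
proof -
  have bdd: "bdd_above ((\<lambda>n. h n x) ` A)" for A x
    by (intro bdd_aboveI[where M="G x"]) (auto intro: le_G)
  have meas [measurable]: "(\<lambda>x. SUP n\<in>{N..}. h n x) \<in> borel_measurable M" for N
    by (intro borel_measurable_cSUP) (auto intro!: bdd)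
  have "(SUP n\<in>{N..}. h n x) \<le> G x" for N x
    by (intro cSUP_least) (auto intro: le_G)
  moreover have "0 \<le> (SUP n\<in>{N..}. h n x)" for N x
    using order_trans[OF nonneg cSUP_upper[OF _ bdd]] by (meson atLeast_iff order_refl)
  ultimately have bound: "norm (SUP n\<in>{N..}. h n x) \<le> G x" for N x by simp
  show "integrable M (\<lambda>x. SUP n\<in>{N..}. h n x)"
    by (rule Bochner_Integration.integrable_bound[OF G meas])
       (rule AE_I2, rule order_trans[OF bound], simp)
  show "(\<lambda>N. \<integral>x. (SUP n\<in>{N..}. h n x) \<partial>M) \<longlonglongrightarrow> 0" if "AE x in M. (\<lambda>n. h n x) \<longlonglongrightarrow> 0"
  proof -
    have "AE x in M. (\<lambda>N. SUP n\<in>{N..}. h n x) \<longlonglongrightarrow> 0"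
      using that by eventually_elim (intro SUP_tail_tendsto_0 bdd nonneg)
    then have "(\<lambda>N. \<integral>x. (SUP n\<in>{N..}. h n x) \<partial>M) \<longlonglongrightarrow> (\<integral>x. 0 \<partial>M)"
      using bound by (intro integral_dominated_convergence[where w=G] G) auto
    then show ?thesis by simp
  qed
qed

lemma ennreal_le_suminf_less: "g \<le> (\<Sum>k::nat. if of_nat k < g then 1 else 0)" for g :: ennreal
proof (rule ccontr)
  let ?h = "\<lambda>k::nat. if of_nat k < g then 1 else 0 :: ennreal"
  assume "\<not> ?thesis"
  then have less: "(\<Sum>k. ?h k) < g" by simp
  then have "(\<Sum>k. ?h k) \<noteq> \<top>" by (auto simp: top_unique)
  then obtain x where x: "0 \<le> x" "(\<Sum>k. ?h k) = ennreal x" by (cases "\<Sum>k. ?h k") auto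
  define N where "N = nat \<lfloor>x\<rfloor>"
  have "of_nat k < g" if "k \<le> N" for k
  proof -
    have "real k \<le> x" using that x(1) unfolding N_def by linarith
    then have "of_nat k \<le> ennreal x" by (simp add: ennreal_of_nat_eq_real_of_nat ennreal_leI)
    also have "\<dots> < g" using less x(2) by simp
    finally show ?thesis .
  qed
  then have "(\<Sum>k<Suc N. ?h k) = of_nat (Suc N)" by (simp add: sum.If_cases Int_absorb1 subset_eq)
  moreover have "(\<Sum>k<Suc N. ?h k) \<le> (\<Sum>k. ?h k)" by (intro sum_le_suminf) auto
  ultimately have "ennreal (real (Suc N)) \<le> ennreal x" using x by (simp only: ennreal_of_nat_eq_real_of_nat)
  then have "real (Suc N) \<le> x" using x(1) by (simp add: ennreal_le_iff del: of_nat_Suc)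
  then show False unfolding N_def by linarith
qed

lemma integrable_majorant_if_summable_tails:
  fixes f :: "nat \<Rightarrow> 'a \<Rightarrow> real"
  assumes [measurable]: "\<And>n. f n \<in> borel_measurable M" and nonneg: "\<And>n x. x \<in> space M \<Longrightarrow> 0 \<le> f n x"
    and tails: "(\<Sum>k. emeasure M {x\<in>space M. \<exists>n. real k < f n x}) < \<infinity>"
  obtains G where "integrable M G" "AE x in M. \<forall>n. \<bar>f n x\<bar> \<le> G x"
proof -
  define g where "g x = (SUP n. ennreal (f n x))" for x
  have g [measurable]: "g \<in> borel_measurable M" unfolding g_def by measurable
  have less_g: "of_nat k < g x \<longleftrightarrow> (\<exists>n. real k < f n x)" if "x \<in> space M" for k :: nat and x
    unfolding g_def less_SUP_iff using nonneg[OF that]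
    by (simp add: ennreal_of_nat_eq_real_of_nat ennreal_less_iff)
  have "(\<integral>\<^sup>+x. g x \<partial>M) \<le> (\<integral>\<^sup>+x. (\<Sum>k::nat. if of_nat k < g x then 1 else 0) \<partial>M)"
    by (intro nn_integral_mono ennreal_le_suminf_less)
  also have "\<dots> = (\<Sum>k::nat. (\<integral>\<^sup>+x. (if of_nat k < g x then 1 else 0) \<partial>M))"
    by (intro nn_integral_suminf) measurable
  also have "\<dots> = (\<Sum>k::nat. (\<integral>\<^sup>+x. indicator {x\<in>space M. \<exists>n. real k < f n x} x \<partial>M))"
    by (intro arg_cong[where f=suminf] ext nn_integral_cong) (simp add: less_g indicator_def)
  also have "\<dots> = (\<Sum>k. emeasure M {x\<in>space M. \<exists>n. real k < f n x})" by simp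
  also note tails
  finally have g_finite: "(\<integral>\<^sup>+x. g x \<partial>M) < \<infinity>" .
  then have "AE x in M. g x \<noteq> \<infinity>" by (intro nn_integral_PInf_AE) auto
  then have g_real: "AE x in M. ennreal (enn2real (g x)) = g x" by eventually_elim (simp add: less_top)
  show thesis
  proof (rule that)
    have "(\<integral>\<^sup>+x. ennreal (enn2real (g x)) \<partial>M) = (\<integral>\<^sup>+x. g x \<partial>M)" using g_real by (rule nn_integral_cong_AE)
    then show "integrable M (\<lambda>x. enn2real (g x))" using g_finite by (intro integrableI_nonneg) auto
    show "AE x in M. \<forall>n. \<bar>f n x\<bar> \<le> enn2real (g x)"
      using g_real AE_space
    proof eventually_elim
      case (elim x)
      have "ennreal (f n x) \<le> g x" for n unfolding g_def by (rule SUP_upper) simp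
      then have "ennreal (f n x) \<le> ennreal (enn2real (g x))" for n by (simp only: elim(1))
      then show ?case using nonneg[OF elim(2)] by simp
    qed
  qed
qed

lemma tendsto_average_shift:
  fixes s :: "nat \<Rightarrow> real"
  assumes "(\<lambda>n. s n / n) \<longlonglongrightarrow> c"
  shows "(\<lambda>n. s (n - N) / n) \<longlonglongrightarrow> c"
proof (rule LIMSEQ_offset[of _ N])
  have "(\<lambda>n. s n / n * (real n / real (n + N))) \<longlonglongrightarrow> c * 1"
    by (intro tendsto_mult assms) real_asymp
  moreover have "\<forall>\<^sub>F n in sequentially. s n / n * (real n / real (n + N)) = s (n + N - N) / real (n + N)"
    using eventually_gt_at_top[of 0] by eventually_elim simp
  ultimately show "(\<lambda>n. s (n + N - N) / real (n + N)) \<longlonglongrightarrow> c"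
    by (simp only: mult_1_right Lim_transform_eventually)
qed

locale measure_preserving = prob_space M for M :: "'a measure" +
  fixes T :: "'a \<Rightarrow> 'a"
  assumes T_measurable [measurable]: "T \<in> measurable M M"
    and distr_T: "distr M M T = M"
begin

lemma funpow_measurable [measurable]: "T ^^ n \<in> measurable M M"
  by (induction n) (auto intro!: measurable_comp[of _ M M T M])

lemma distr_funpow: "distr M M (T ^^ n) = M"
proof (induction n)
  case (Suc n)
  have "distr M M (T ^^ Suc n) = distr (distr M M (T ^^ n)) M T"
    using distr_distr[OF T_measurable funpow_measurable, of n] by (simp add: comp_def)
  then show ?case by (simp only: Suc distr_T)
qed (simp add: id_def)

lemma prob_vimage_funpow: "A \<in> events \<Longrightarrow> prob ((T ^^ n) -` A \<inter> space M) = prob A"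
  using measure_distr[OF funpow_measurable, of A n] by (simp only: distr_funpow)

lemma AE_funpow:
  assumes "AE x in M. P x"
  shows "AE x in M. \<forall>n. P ((T ^^ n) x)"
  unfolding AE_all_countable
proof
  fix n
  have "AE x in distr M M (T ^^ n). P x" using assms by (subst distr_funpow)
  from AE_distrD[OF funpow_measurable this] show "AE x in M. P ((T ^^ n) x)" .
qed

lemma integrable_compose_T: "integrable M f \<Longrightarrow> integrable M (\<lambda>x. f (T x))" for f :: "'a \<Rightarrow> real"
  using integrable_distr[OF T_measurable, of f] by (simp add: distr_T)

lemma integral_compose_T: "f \<in> borel_measurable M \<Longrightarrow> (\<integral>x. f (T x) \<partial>M) = (\<integral>x. f x \<partial>M)"
  for f :: "'a \<Rightarrow> real"
  using integral_distr[OF T_measurable, of f] by (simp add: distr_T)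

definition birkhoff_sum :: "('a \<Rightarrow> real) \<Rightarrow> nat \<Rightarrow> 'a \<Rightarrow> real" where
  "birkhoff_sum f n x = (\<Sum>k<n. f ((T ^^ k) x))"

lemma birkhoff_sum_Suc: "birkhoff_sum f (Suc n) x = f x + birkhoff_sum f n (T x)"
  unfolding birkhoff_sum_def by (subst sum.lessThan_Suc_shift) (simp add: funpow_swap1)

text \<open>\<open>birkhoff_max f n x\<close> is the maximum of the sums \<open>birkhoff_sum f k x\<close> over \<open>k \<le> n\<close>.\<close>

primrec birkhoff_max :: "('a \<Rightarrow> real) \<Rightarrow> nat \<Rightarrow> 'a \<Rightarrow> real" where
  "birkhoff_max f 0 x = 0"
| "birkhoff_max f (Suc n) x = max 0 (f x + birkhoff_max f n (T x))"

lemma birkhoff_max_nonneg: "0 \<le> birkhoff_max f n x"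
  by (cases n) auto

lemma birkhoff_sum_le_max: "birkhoff_sum f n x \<le> birkhoff_max f n x"
proof (induction n arbitrary: x)
  case (Suc n)
  then show ?case using Suc[of "T x"] by (auto simp: birkhoff_sum_Suc le_max_iff_disj)
qed (simp add: birkhoff_sum_def)

lemma birkhoff_max_le_Suc: "birkhoff_max f n x \<le> birkhoff_max f (Suc n) x"
proof (induction n arbitrary: x)
  case (Suc n)
  have "max 0 (f x + a) \<le> max 0 (f x + b)" if "a \<le> b" for a b using that by auto
  from this[OF Suc[of "T x"]] show ?case by (simp only: birkhoff_max.simps(2))
qed simp

lemma birkhoff_max_mono: "m \<le> n \<Longrightarrow> birkhoff_max f m x \<le> birkhoff_max f n x"
  by (rule lift_Suc_mono_le[of "\<lambda>n. birkhoff_max f n x"])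
     (auto simp del: birkhoff_max.simps intro: birkhoff_max_le_Suc)

lemma birkhoff_max_measurable [measurable]:
  assumes [measurable]: "f \<in> borel_measurable M"
  shows "birkhoff_max f n \<in> borel_measurable M"
proof (induction n)
  case 0
  have "birkhoff_max f 0 = (\<lambda>x. 0)" by auto
  then show ?case by simp
next
  case (Suc n)
  note Suc [measurable]
  show ?case by simp
qed

lemma birkhoff_max_integrable:
  assumes f: "integrable M f"
  shows "integrable M (birkhoff_max f n)"
proof (induction n)
  case 0
  have "birkhoff_max f 0 = (\<lambda>x. 0)" by auto
  then show ?case by simp
next
  case (Suc n)
  then show ?case
    using f by (auto intro!: Bochner_Integration.integrable_max Bochner_Integration.integrable_add
        integrable_compose_T)
qed

lemma integral_birkhoff_max_increment_nonneg:
  assumes f: "integrable M f"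
  shows "0 \<le> (\<integral>x. max (- birkhoff_max f n (T x)) (f x) \<partial>M)"
proof -
  note [measurable] = borel_measurable_integrable[OF f]
  have "(\<integral>x. max (- birkhoff_max f n (T x)) (f x) \<partial>M)
      = (\<integral>x. birkhoff_max f (Suc n) x - birkhoff_max f n (T x) \<partial>M)"
    by (intro Bochner_Integration.integral_cong) auto
  also have "\<dots> = (\<integral>x. birkhoff_max f (Suc n) x \<partial>M) - (\<integral>x. birkhoff_max f n (T x) \<partial>M)"
    by (intro Bochner_Integration.integral_diff integrable_compose_T birkhoff_max_integrable f)
  also have "(\<integral>x. birkhoff_max f n (T x) \<partial>M) = (\<integral>x. birkhoff_max f n x \<partial>M)"
    by (intro integral_compose_T) simp
  moreover have "(\<integral>x. birkhoff_max f n x \<partial>M) \<le> (\<integral>x. birkhoff_max f (Suc n) x \<partial>M)"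
    by (intro integral_mono birkhoff_max_integrable f birkhoff_max_le_Suc)
  ultimately show ?thesis by simp
qed

definition birkhoff_unbounded :: "('a \<Rightarrow> real) \<Rightarrow> 'a set" where
  "birkhoff_unbounded f = {x \<in> space M. \<forall>c::nat. \<exists>n. real c < birkhoff_max f n x}"

lemma birkhoff_unbounded_sets [measurable]:
  "f \<in> borel_measurable M \<Longrightarrow> birkhoff_unbounded f \<in> events"
  unfolding birkhoff_unbounded_def by measurable

lemma birkhoff_unboundedD:
  assumes "x \<in> birkhoff_unbounded f"
  obtains n where "r < birkhoff_max f n x"
proof -
  obtain n where "real (nat \<lceil>r\<rceil>) < birkhoff_max f n x"
    using assms unfolding birkhoff_unbounded_def by blast
  then have "r < birkhoff_max f n x" by linarith
  then show thesis by (rule that)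
qed

lemma birkhoff_unbounded_invariant: "T -` birkhoff_unbounded f \<inter> space M = birkhoff_unbounded f"
proof -
  have "T x \<in> birkhoff_unbounded f \<longleftrightarrow> x \<in> birkhoff_unbounded f" if x: "x \<in> space M" for x
  proof
    assume unbounded: "T x \<in> birkhoff_unbounded f"
    have "\<exists>n. real c < birkhoff_max f n x" for c :: nat
    proof -
      obtain n where "real c - f x < birkhoff_max f n (T x)" using birkhoff_unboundedD[OF unbounded] .
      then show ?thesis by (intro exI[of _ "Suc n"]) simp
    qed
    then show "x \<in> birkhoff_unbounded f" using x by (auto simp: birkhoff_unbounded_def)
  next
    assume unbounded: "x \<in> birkhoff_unbounded f"
    have "\<exists>n. real c < birkhoff_max f n (T x)" for c :: nat
    proof -
      obtain n where "max 0 (real c + f x) < birkhoff_max f n x" using birkhoff_unboundedD[OF unbounded] .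
      also have "birkhoff_max f n x \<le> birkhoff_max f (Suc n) x" by (rule birkhoff_max_le_Suc)
      finally show ?thesis by (intro exI[of _ n]) (auto simp: max_def split: if_splits)
    qed
    then show "T x \<in> birkhoff_unbounded f"
      using measurable_space[OF T_measurable x] by (auto simp: birkhoff_unbounded_def)
  qed
  then show ?thesis by (auto simp: birkhoff_unbounded_def)
qed

text \<open>Where the Birkhoff sums are unbounded above, the increments
  \<open>birkhoff_max f (Suc n) - birkhoff_max f n \<circ> T = max (- birkhoff_max f n \<circ> T) f\<close> decrease to \<open>f\<close>,
  while their integrals are nonnegative.\<close>

lemma integral_nonneg_if_birkhoff_unbounded:
  assumes f: "integrable M f" and unbounded: "AE x in M. x \<in> birkhoff_unbounded f"
  shows "0 \<le> (\<integral>x. f x \<partial>M)"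
proof -
  let ?d = "\<lambda>n x. max (- birkhoff_max f n (T x)) (f x)"
  have "(\<lambda>n. \<integral>x. ?d n x \<partial>M) \<longlonglongrightarrow> (\<integral>x. f x \<partial>M)"
  proof (rule integral_dominated_convergence[where w="\<lambda>x. \<bar>f x\<bar>"])
    show "AE x in M. (\<lambda>n. ?d n x) \<longlonglongrightarrow> f x"
      using AE_funpow[OF unbounded]
    proof eventually_elim
      case (elim x)
      then have "T x \<in> birkhoff_unbounded f" by (auto dest!: spec[of _ 1])
      then obtain n where n: "\<bar>f x\<bar> < birkhoff_max f n (T x)" by (rule birkhoff_unboundedD)
      have "?d m x = f x" if "n \<le> m" for m
        using n birkhoff_max_mono[OF that, of f "T x"] by linarith
      then show "(\<lambda>n. ?d n x) \<longlonglongrightarrow> f x"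
        by (intro tendsto_eventually) (auto simp: eventually_sequentially)
    qed
    show "AE x in M. norm (?d n x) \<le> \<bar>f x\<bar>" for n
    proof (rule AE_I2)
      fix x
      show "norm (?d n x) \<le> \<bar>f x\<bar>" using birkhoff_max_nonneg[of f n "T x"] by auto
    qed
  qed (use f in auto)
  then show ?thesis
    using integral_birkhoff_max_increment_nonneg[OF f] by (intro LIMSEQ_le_const) auto
qed

lemma sum_triangular_le_birkhoff_sum:
  fixes h :: "nat \<Rightarrow> 'a \<Rightarrow> real"
  assumes nonneg: "\<And>n x. 0 \<le> h n x" and le_G: "\<And>n x. h n x \<le> G x" and "N \<le> n"
  shows "(\<Sum>k<n. h (n - k) ((T ^^ k) x))
    \<le> birkhoff_sum (\<lambda>x. SUP n\<in>{N..}. h n x) n x + (birkhoff_sum G n x - birkhoff_sum G (n - N) x)"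
proof -
  let ?D = "\<lambda>x. SUP n\<in>{N..}. h n x"
  have split: "(\<Sum>k<n. u k) = (\<Sum>k<n - N. u k) + (\<Sum>k=n - N..<n. u k)" for u :: "nat \<Rightarrow> real"
    by (simp add: lessThan_atLeast0 sum.atLeastLessThan_concat)
  have h_le_D: "h m y \<le> ?D y" if "N \<le> m" for m y
    using that by (intro cSUP_upper bdd_aboveI[where M="G y"]) (auto intro: le_G)
  have D_nonneg: "0 \<le> ?D y" for y by (rule order_trans[OF nonneg h_le_D]) auto
  have "(\<Sum>k<n - N. h (n - k) ((T ^^ k) x)) \<le> (\<Sum>k<n - N. ?D ((T ^^ k) x))"
    by (intro sum_mono h_le_D) auto
  also have "\<dots> \<le> birkhoff_sum ?D n x"
    unfolding birkhoff_sum_def by (intro sum_mono2 D_nonneg) auto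
  finally have "(\<Sum>k<n - N. h (n - k) ((T ^^ k) x)) \<le> birkhoff_sum ?D n x" .
  moreover have "(\<Sum>k=n - N..<n. h (n - k) ((T ^^ k) x)) \<le> (\<Sum>k=n - N..<n. G ((T ^^ k) x))"
    by (intro sum_mono le_G)
  moreover have "(\<Sum>k=n - N..<n. G ((T ^^ k) x)) = birkhoff_sum G n x - birkhoff_sum G (n - N) x"
    unfolding birkhoff_sum_def split[of "\<lambda>k. G ((T ^^ k) x)"] by simp
  ultimately show ?thesis unfolding split by linarith
qed

lemma triangular_average_diff_le:
  fixes g :: "nat \<Rightarrow> 'a \<Rightarrow> real"
  shows "\<bar>(\<Sum>k<n. g (n - k) ((T ^^ k) x)) / n - birkhoff_sum f n x / n\<bar>
    \<le> (\<Sum>k<n. \<bar>g (n - k) ((T ^^ k) x) - f ((T ^^ k) x)\<bar>) / n"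
proof -
  have "\<bar>(\<Sum>k<n. g (n - k) ((T ^^ k) x)) - birkhoff_sum f n x\<bar>
      \<le> (\<Sum>k<n. \<bar>g (n - k) ((T ^^ k) x) - f ((T ^^ k) x)\<bar>)"
    unfolding birkhoff_sum_def sum_subtractf[symmetric] by (rule sum_abs)
  then show ?thesis by (simp add: diff_divide_distrib[symmetric] divide_right_mono)
qed

lemma triangular_average_eventually_less:
  fixes h :: "nat \<Rightarrow> 'a \<Rightarrow> real"
  assumes nonneg: "\<And>n x. 0 \<le> h n x" and le_G: "\<And>n x. h n x \<le> G x"
    and lim_SUP: "(\<lambda>n. birkhoff_sum (\<lambda>x. SUP n\<in>{N..}. h n x) n x / n) \<longlonglongrightarrow> d" and "d < e"
    and lim_G: "(\<lambda>n. birkhoff_sum G n x / n) \<longlonglongrightarrow> c"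
  shows "\<forall>\<^sub>F n in sequentially. (\<Sum>k<n. h (n - k) ((T ^^ k) x)) / n < e"
proof -
  let ?D = "\<lambda>x. SUP n\<in>{N..}. h n x"
  have "(\<lambda>n. birkhoff_sum ?D n x / n + (birkhoff_sum G n x / n - birkhoff_sum G (n - N) x / n))
      \<longlonglongrightarrow> d + (c - c)"
    by (intro tendsto_intros tendsto_average_shift lim_SUP lim_G)
  then have "\<forall>\<^sub>F n in sequentially.
      birkhoff_sum ?D n x / n + (birkhoff_sum G n x / n - birkhoff_sum G (n - N) x / n) < e"
    using \<open>d < e\<close> by (intro order_tendstoD(2)) auto
  with eventually_ge_at_top[of N] show ?thesis
  proof eventually_elim
    case (elim n)
    have "(\<Sum>k<n. h (n - k) ((T ^^ k) x)) / n
        \<le> (birkhoff_sum ?D n x + (birkhoff_sum G n x - birkhoff_sum G (n - N) x)) / n"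
      by (intro divide_right_mono sum_triangular_le_birkhoff_sum nonneg le_G elim) simp
    also have "\<dots> < e" using elim(2) by (simp add: add_divide_distrib diff_divide_distrib)
    finally show ?case .
  qed
qed

end

locale ergodic_system = measure_preserving +
  assumes ergodic: "\<And>A. A \<in> sets M \<Longrightarrow> T -` A \<inter> space M = A \<Longrightarrow> prob A = 0 \<or> prob A = 1"
begin

lemma birkhoff_sum_bounded_above:
  assumes f: "integrable M f" and neg: "(\<integral>x. f x \<partial>M) < 0"
  shows "AE x in M. \<exists>c. \<forall>n. birkhoff_sum f n x \<le> c"
proof -
  note [measurable] = borel_measurable_integrable[OF f]
  have "\<not> (AE x in M. x \<in> birkhoff_unbounded f)"
    using integral_nonneg_if_birkhoff_unbounded[OF f] neg by linarith
  then have "prob (birkhoff_unbounded f) \<noteq> 1" by (simp add: prob_eq_1)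
  then have "prob (birkhoff_unbounded f) = 0"
    using ergodic[OF _ birkhoff_unbounded_invariant, of f] by simp
  then have "AE x in M. x \<notin> birkhoff_unbounded f" by (simp add: prob_eq_0)
  with AE_space show ?thesis
  proof eventually_elim
    case (elim x)
    then obtain c :: nat where "\<forall>n. birkhoff_max f n x \<le> real c"
      by (auto simp: birkhoff_unbounded_def not_less)
    then show ?case using birkhoff_sum_le_max order_trans by blast
  qed
qed

lemma birkhoff_average_eventually_less:
  assumes f: "integrable M f" and "0 < e"
  shows "AE x in M. \<forall>\<^sub>F n in sequentially. birkhoff_sum f n x / n < (\<integral>x. f x \<partial>M) + e"
proof -
  define c where "c = (\<integral>x. f x \<partial>M) + e / 2"
  have "(\<integral>x. f x - c \<partial>M) < 0"
    using f \<open>0 < e\<close> by (simp add: prob_space c_def)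
  then have "AE x in M. \<exists>B. \<forall>n. birkhoff_sum (\<lambda>x. f x - c) n x \<le> B"
    using f by (intro birkhoff_sum_bounded_above) auto
  then show ?thesis
  proof eventually_elim
    case (elim x)
    then obtain B where "\<And>n. birkhoff_sum (\<lambda>x. f x - c) n x \<le> B" by blast
    then have sum_le: "birkhoff_sum f n x \<le> B + n * c" for n
      by (simp add: birkhoff_sum_def sum_subtractf algebra_simps)
    have "\<forall>\<^sub>F n in sequentially. B / real n + c < (\<integral>x. f x \<partial>M) + e"
      using \<open>0 < e\<close> unfolding c_def
      by (intro order_tendstoD(2)[OF tendsto_add[OF lim_const_over_n tendsto_const]]) auto
    with eventually_gt_at_top[of 0] show ?case
    proof eventually_elim
      case (elim n)
      have "birkhoff_sum f n x / n \<le> (B + n * c) / n" by (intro divide_right_mono sum_le) auto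
      also have "\<dots> = B / n + c" using elim by (simp add: field_simps)
      also have "\<dots> < (\<integral>x. f x \<partial>M) + e" by (rule elim(2))
      finally show ?case .
    qed
  qed
qed

theorem birkhoff_ergodic:
  assumes f: "integrable M f"
  shows "AE x in M. (\<lambda>n. birkhoff_sum f n x / n) \<longlonglongrightarrow> (\<integral>x. f x \<partial>M)"
proof -
  have upper: "AE x in M. \<forall>k::nat. \<forall>\<^sub>F n in sequentially.
      birkhoff_sum g n x / n < (\<integral>x. g x \<partial>M) + inverse (real (Suc k))" if "integrable M g" for g
    unfolding AE_all_countable using birkhoff_average_eventually_less[OF that] by simp
  have "integrable M (\<lambda>x. - f x)" using f by simp
  from upper[OF f] upper[OF this] show ?thesis
  proof eventually_elim
    case (elim x)
    have neg: "birkhoff_sum (\<lambda>x. - f x) n x = - birkhoff_sum f n x" for n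
      by (simp add: birkhoff_sum_def sum_negf)
    show ?case unfolding tendsto_iff_dist_less_inverse_Suc
    proof
      fix k
      show "\<forall>\<^sub>F n in sequentially. dist (birkhoff_sum f n x / n) (\<integral>x. f x \<partial>M) < inverse (real (Suc k))"
        using elim[THEN spec, of k] by eventually_elim (auto simp: dist_real_def neg)
    qed
  qed
qed

lemma maker_ergodic_null:
  fixes h :: "nat \<Rightarrow> 'a \<Rightarrow> real"
  assumes [measurable]: "\<And>n. h n \<in> borel_measurable M" and G: "integrable M G"
    and nonneg: "\<And>n x. 0 \<le> h n x" and le_G: "\<And>n x. h n x \<le> G x"
    and "AE x in M. (\<lambda>n. h n x) \<longlonglongrightarrow> 0"
  shows "AE x in M. (\<lambda>n. (\<Sum>k<n. h (n - k) ((T ^^ k) x)) / n) \<longlonglongrightarrow> 0"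
proof -
  define D where "D N x = (SUP n\<in>{N..}. h n x)" for N x
  have D_integrable: "integrable M (D N)" for N
    unfolding D_def by (rule integrable_SUP_tail) (use assms in auto)
  have D_lim: "(\<lambda>N. \<integral>x. D N x \<partial>M) \<longlonglongrightarrow> 0"
    unfolding D_def by (rule integral_SUP_tail_tendsto_0) (use assms in auto)
  have "AE x in M. \<forall>N. (\<lambda>n. birkhoff_sum (D N) n x / n) \<longlonglongrightarrow> (\<integral>x. D N x \<partial>M)"
    unfolding AE_all_countable using birkhoff_ergodic[OF D_integrable] by blast
  with birkhoff_ergodic[OF G] show ?thesis
  proof eventually_elim
    case (elim x)
    show ?case
    proof (rule order_tendstoI)
      fix e :: real assume "0 < e"
      then obtain N where N: "(\<integral>x. D N x \<partial>M) < e"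
        using order_tendstoD(2)[OF D_lim] by (auto simp: eventually_sequentially)
      have "(\<lambda>n. birkhoff_sum (\<lambda>x. SUP n\<in>{N..}. h n x) n x / n) \<longlonglongrightarrow> (\<integral>x. D N x \<partial>M)"
        using elim(2) unfolding D_def by blast
      from triangular_average_eventually_less[OF nonneg le_G this N elim(1)]
      show "\<forall>\<^sub>F n in sequentially. (\<Sum>k<n. h (n - k) ((T ^^ k) x)) / n < e" .
    next
      fix e :: real assume "e < 0"
      then have "e < (\<Sum>k<n. h (n - k) ((T ^^ k) x)) / n" for n
        by (rule less_le_trans) (auto intro!: divide_nonneg_nonneg sum_nonneg nonneg)
      then show "\<forall>\<^sub>F n in sequentially. e < (\<Sum>k<n. h (n - k) ((T ^^ k) x)) / n" by simp
    qed
  qed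
qed

theorem maker_ergodic:
  fixes f :: "'a \<Rightarrow> real" and g :: "nat \<Rightarrow> 'a \<Rightarrow> real"
  assumes [measurable]: "f \<in> borel_measurable M" "\<And>n. g n \<in> borel_measurable M"
    and G: "integrable M G" and bound: "AE x in M. \<forall>n. \<bar>g n x\<bar> \<le> G x"
    and lim: "AE x in M. (\<lambda>n. g n x) \<longlonglongrightarrow> f x"
  shows "AE x in M. (\<lambda>n. (\<Sum>k<n. g (n - k) ((T ^^ k) x)) / n) \<longlonglongrightarrow> (\<integral>x. f x \<partial>M)"
proof -
  note [measurable] = borel_measurable_integrable[OF G]
  have f: "integrable M f"
    by (rule integrable_dominated_convergence[OF _ _ G lim]) (use bound in \<open>auto elim!: eventually_mono\<close>)
  define h where "h n x = min \<bar>g n x - f x\<bar> (\<bar>G x\<bar> + \<bar>f x\<bar>)" for n x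
  have "AE x in M. (\<lambda>n. h n x) \<longlonglongrightarrow> 0"
    using lim
  proof eventually_elim
    case (elim x)
    then have "(\<lambda>n. h n x) \<longlonglongrightarrow> min \<bar>f x - f x\<bar> (\<bar>G x\<bar> + \<bar>f x\<bar>)"
      unfolding h_def by (intro tendsto_intros)
    then show ?case by simp
  qed
  moreover have "integrable M (\<lambda>x. \<bar>G x\<bar> + \<bar>f x\<bar>)" using G f by simp
  ultimately have null: "AE x in M. (\<lambda>n. (\<Sum>k<n. h (n - k) ((T ^^ k) x)) / n) \<longlonglongrightarrow> 0"
    by (intro maker_ergodic_null[where G="\<lambda>x. \<bar>G x\<bar> + \<bar>f x\<bar>"]) (auto simp: h_def)
  have "AE x in M. \<forall>n. \<bar>g n x - f x\<bar> = h n x"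
    using bound
  proof eventually_elim
    case (elim x)
    have "\<bar>g n x - f x\<bar> \<le> \<bar>G x\<bar> + \<bar>f x\<bar>" for n using elim[rule_format, of n] by linarith
    then show ?case by (simp add: h_def)
  qed
  from birkhoff_ergodic[OF f] null AE_funpow[OF this] show ?thesis
  proof eventually_elim
    case (elim x)
    have "(\<lambda>n. (\<Sum>k<n. g (n - k) ((T ^^ k) x)) / n - birkhoff_sum f n x / n) \<longlonglongrightarrow> 0"
      using triangular_average_diff_le[where g=g and f=f and x=x] elim(3)
      by (intro Lim_null_comparison[OF _ elim(2)] always_eventually) simp
    from tendsto_add[OF this elim(1)] show ?case by simp
  qed
qed

end

section \<open>Differentiation of measures on the real line\<close>

lemma redundant_interval:
  fixes l u :: "'i \<Rightarrow> 'a::linorder"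
  assumes fin: "finite H" and card: "2 < card H" and x: "\<And>i. i \<in> H \<Longrightarrow> x \<in> {l i<..<u i}"
  obtains k where "k \<in> H" "{l k<..<u k} \<subseteq> (\<Union>i\<in>H - {k}. {l i<..<u i})"
proof -
  have ne: "H \<noteq> {}" using card by auto
  have "Min (l ` H) \<in> l ` H" using fin ne by (intro Min_in) auto
  then obtain a where a: "a \<in> H" and Min_eq: "Min (l ` H) = l a" by blast
  have "Max (u ` H) \<in> u ` H" using fin ne by (intro Max_in) auto
  then obtain c where c: "c \<in> H" and Max_eq: "Max (u ` H) = u c" by blast
  have "card {a, c} \<le> 2" by (simp add: card_insert_if)
  then have "\<not> H \<subseteq> {a, c}" using card card_mono[of "{a, c}" H] by auto
  then obtain k where k: "k \<in> H" "k \<noteq> a" "k \<noteq> c" by auto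
  have "l a \<le> l k" "u k \<le> u c"
    unfolding Min_eq[symmetric] Max_eq[symmetric] using fin k(1) by (auto intro: Min_le Max_ge)
  then have "y \<in> {l a<..<u a} \<union> {l c<..<u c}" if "y \<in> {l k<..<u k}" for y
    using x[OF a] x[OF c] that by (cases "y < x") auto
  then show thesis using that[OF k(1)] a c k by blast
qed

lemma finite_interval_subcover:
  fixes l u :: "'i \<Rightarrow> 'a::linorder"
  assumes "finite I"
  obtains J where "J \<subseteq> I" "(\<Union>i\<in>J. {l i<..<u i}) = (\<Union>i\<in>I. {l i<..<u i})"
    "\<And>x. card {i\<in>J. x \<in> {l i<..<u i}} \<le> 2"
proof -
  let ?covers = "\<lambda>J. J \<subseteq> I \<and> (\<Union>i\<in>J. {l i<..<u i}) = (\<Union>i\<in>I. {l i<..<u i})"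
  define J where "J = arg_min card ?covers"
  have J: "?covers J" and minimal: "\<And>J'. ?covers J' \<Longrightarrow> card J \<le> card J'"
    using arg_min_nat_lemma[of ?covers I card] unfolding J_def by auto
  have fin: "finite J" using J assms finite_subset by blast
  have "card {i\<in>J. x \<in> {l i<..<u i}} \<le> 2" for x
  proof (rule ccontr)
    let ?H = "{i\<in>J. x \<in> {l i<..<u i}}"
    assume "\<not> card ?H \<le> 2"
    then obtain k where k: "k \<in> ?H" "{l k<..<u k} \<subseteq> (\<Union>i\<in>?H - {k}. {l i<..<u i})"
      using redundant_interval[of ?H x l u] fin by auto
    then have "?covers (J - {k})" using J by blast
    from minimal[OF this] have "card J \<le> card (J - {k})" .
    moreover have "card (J - {k}) < card J" using fin k(1) by (intro card_Diff1_less) auto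
    ultimately show False by simp
  qed
  with J that show ?thesis by blast
qed

lemma finite_interval_maximal_inequality:
  fixes m \<mu> :: "'a::{linorder_topology, second_countable_topology} measure" and l u :: "'i \<Rightarrow> 'a"
  assumes "finite_measure m" "finite_measure \<mu>" and sets: "sets m = sets borel" "sets \<mu> = sets borel"
    and "0 < t" "U \<in> sets borel" "finite I"
    and sub: "\<And>i. i \<in> I \<Longrightarrow> {l i<..<u i} \<subseteq> U"
    and heavy: "\<And>i. i \<in> I \<Longrightarrow> t * measure m {l i<..<u i} \<le> measure \<mu> {l i<..<u i}"
  shows "t * measure m (\<Union>i\<in>I. {l i<..<u i}) \<le> 2 * measure \<mu> U"
proof -
  interpret m: finite_measure m by fact
  interpret \<mu>: finite_measure \<mu> by fact
  note [simp] = sets sets_eq_imp_space_eq[OF sets(2)] and [measurable] = \<open>U \<in> sets borel\<close>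
  obtain J where J: "J \<subseteq> I" "(\<Union>i\<in>J. {l i<..<u i}) = (\<Union>i\<in>I. {l i<..<u i})"
    and overlap: "\<And>x. card {i\<in>J. x \<in> {l i<..<u i}} \<le> 2"
    using finite_interval_subcover[OF \<open>finite I\<close>] by blast
  have fin: "finite J" using J(1) \<open>finite I\<close> finite_subset by blast
  have count: "(\<Sum>i\<in>J. indicator {l i<..<u i} x) \<le> (2 * indicator U x :: real)" for x
  proof (cases "x \<in> U")
    case True
    have "(\<Sum>i\<in>J. indicator {l i<..<u i} x :: real) = card {i\<in>J. x \<in> {l i<..<u i}}"
      using fin by (simp add: indicator_def sum.If_cases Int_def)
    then show ?thesis using overlap[of x] True by simp
  next
    case False
    then have "x \<notin> {l i<..<u i}" if "i \<in> J" for i using sub J(1) that by blast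
    then have "(\<Sum>i\<in>J. indicator {l i<..<u i} x) = (0::real)"
      by (intro sum.neutral) (simp add: indicator_def)
    then show ?thesis using False by simp
  qed
  have "t * measure m (\<Union>i\<in>I. {l i<..<u i}) \<le> t * (\<Sum>i\<in>J. measure m {l i<..<u i})"
    unfolding J(2)[symmetric] using \<open>0 < t\<close> fin
    by (intro mult_left_mono m.finite_measure_subadditive_finite) auto
  also have "\<dots> \<le> (\<Sum>i\<in>J. measure \<mu> {l i<..<u i})"
    unfolding sum_distrib_left using heavy J(1) by (intro sum_mono) auto
  also have "\<dots> = (\<integral>x. (\<Sum>i\<in>J. indicator {l i<..<u i} x) \<partial>\<mu>)"
    by (subst Bochner_Integration.integral_sum) (auto simp: less_top[symmetric])
  also have "\<dots> \<le> (\<integral>x. 2 * indicator U x \<partial>\<mu>)"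
    by (intro integral_mono count) (auto simp: less_top[symmetric])
  also have "\<dots> = 2 * measure \<mu> U" by simp
  finally show ?thesis .
qed

lemma interval_maximal_inequality:
  fixes m \<mu> :: "'a::{linorder_topology, second_countable_topology} measure" and l u :: "'i \<Rightarrow> 'a"
  assumes "finite_measure m" "finite_measure \<mu>" and sets: "sets m = sets borel" "sets \<mu> = sets borel"
    and "0 < t" "U \<in> sets borel"
    and "\<And>i. i \<in> I \<Longrightarrow> {l i<..<u i} \<subseteq> U"
    and "\<And>i. i \<in> I \<Longrightarrow> t * measure m {l i<..<u i} \<le> measure \<mu> {l i<..<u i}"
  shows "t * measure m (\<Union>i\<in>I. {l i<..<u i}) \<le> 2 * measure \<mu> U"
proof -
  interpret m: finite_measure m by fact
  let ?I = "\<lambda>i. {l i<..<u i}"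
  obtain \<H> where \<H>: "\<H> \<subseteq> ?I ` I" "countable \<H>" "\<Union>\<H> = (\<Union>i\<in>I. ?I i)"
    by (rule Lindelof[of "?I ` I"]) auto
  obtain J where J: "J \<subseteq> I" "countable J" "\<H> = ?I ` J"
    using countable_subset_image[of \<H> ?I I] \<H>(1,2) by blast
  show ?thesis
  proof (cases "J = {}")
    case True
    then show ?thesis using \<H>(3) J(3) by simp
  next
    case False
    let ?V = "\<lambda>n. (\<Union>i\<in>from_nat_into J ` {..n}. ?I i)"
    have "(\<lambda>n. measure m (?V n)) \<longlonglongrightarrow> measure m (\<Union>n. ?V n)"
    proof (rule m.finite_Lim_measure_incseq)
      show "incseq ?V" by (intro monoI UN_mono image_mono) auto
    qed (auto simp: sets)
    also have "(\<Union>n. ?V n) = (\<Union>i\<in>range (from_nat_into J). ?I i)" by auto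
    also have "\<dots> = (\<Union>i\<in>I. ?I i)" using J False \<H>(3) by (simp add: range_from_nat_into)
    finally have "(\<lambda>n. t * measure m (?V n)) \<longlonglongrightarrow> t * measure m (\<Union>i\<in>I. ?I i)"
      by (intro tendsto_intros)
    moreover have "from_nat_into J n \<in> I" for n using from_nat_into[OF False] J(1) by auto
    then have "t * measure m (?V n) \<le> 2 * measure \<mu> U" for n
      by (intro finite_interval_maximal_inequality assms) auto
    ultimately show ?thesis by (intro LIMSEQ_le_const2) auto
  qed
qed

definition maximal_set :: "'a::metric_space measure \<Rightarrow> 'a measure \<Rightarrow> real \<Rightarrow> 'a set \<Rightarrow> 'a set" where
  "maximal_set m \<mu> t U =
     \<Union>{ball y s | y s. ball y s \<subseteq> U \<and> t * measure m (ball y s) \<le> measure \<mu> (ball y s)}"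

lemma open_maximal_set: "open (maximal_set m \<mu> t U)"
  unfolding maximal_set_def by auto

lemma maximal_set_borel [measurable]: "maximal_set m \<mu> t U \<in> sets borel"
  by (intro borel_open open_maximal_set)

lemma maximal_setI:
  assumes "t * measure m (ball y s) \<le> measure \<mu> (ball y s)" "ball y s \<subseteq> U" "0 < s"
  shows "y \<in> maximal_set m \<mu> t U"
proof -
  have "y \<in> ball y s" using \<open>0 < s\<close> by simp
  with assms(1,2) show ?thesis unfolding maximal_set_def by blast
qed

lemma maximal_setI_frequently:
  assumes U: "open U" "y \<in> U"
    and heavy: "\<exists>\<^sub>F s in at_right 0. t * measure m (ball y s) < measure \<mu> (ball y s)"
  shows "y \<in> maximal_set m \<mu> t U"
proof -
  obtain r where r: "0 < r" "ball y r \<subseteq> U" using U openE by blast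
  have "\<forall>\<^sub>F s in at_right 0. s \<in> {0<..<r}" using r(1) by (rule eventually_at_right_real)
  with heavy have "\<exists>\<^sub>F s in at_right 0. t * measure m (ball y s) < measure \<mu> (ball y s) \<and> s \<in> {0<..<r}"
    by (rule frequently_eventually_frequently)
  then obtain s where s: "t * measure m (ball y s) < measure \<mu> (ball y s)" "0 < s" "s < r"
    by (auto dest: frequently_ex)
  then have "ball y s \<subseteq> U" using r(2) by auto
  with s show ?thesis by (intro maximal_setI) auto
qed

lemma measure_maximal_set_le:
  fixes m \<mu> :: "real measure"
  assumes "finite_measure m" "finite_measure \<mu>" "sets m = sets borel" "sets \<mu> = sets borel"
    and "0 < t" "U \<in> sets borel"
  shows "t * measure m (maximal_set m \<mu> t U) \<le> 2 * measure \<mu> U"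
proof -
  let ?I = "{(y, s). ball y s \<subseteq> U \<and> t * measure m (ball y s) \<le> measure \<mu> (ball y s)}"
  let ?l = "\<lambda>(y, s). y - s" and ?u = "\<lambda>(y, s). y + s"
  have interval_ball: "{?l i<..<?u i} = ball (fst i) (snd i)" for i
    by (cases i) (simp add: ball_eq_greaterThanLessThan)
  have "t * measure m (\<Union>i\<in>?I. {?l i<..<?u i}) \<le> 2 * measure \<mu> U"
    by (intro interval_maximal_inequality assms) (auto simp: interval_ball)
  also have "(\<Union>i\<in>?I. {?l i<..<?u i}) = maximal_set m \<mu> t U"
    unfolding interval_ball maximal_set_def by (auto simp del: mem_ball) blast+
  finally show ?thesis .
qed

lemma (in finite_measure) AE_notin_if_small_covers:
  assumes "\<And>e. 0 < e \<Longrightarrow> \<exists>V\<in>sets M. N \<subseteq> V \<and> measure M V \<le> e"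
  shows "AE x in M. x \<notin> N"
proof -
  have "\<exists>V\<in>sets M. N \<subseteq> V \<and> measure M V \<le> inverse (real (Suc k))" for k
    using assms[of "inverse (real (Suc k))"] by simp
  then obtain V where V: "\<And>k. V k \<in> sets M" "\<And>k. N \<subseteq> V k" "\<And>k. measure M (V k) \<le> inverse (real (Suc k))"
    by metis
  have "measure M (\<Inter>k. V k) \<le> inverse (real (Suc k))" for k
    by (rule order_trans[OF finite_measure_mono V(3)]) (auto intro: V(1))
  then have "measure M (\<Inter>k. V k) \<le> 0"
    by (intro LIMSEQ_le_const[OF LIMSEQ_inverse_real_of_nat]) blast
  then have "(\<Inter>k. V k) \<in> null_sets M"
    using V(1) by (intro null_setsI) (auto simp: emeasure_eq_measure measure_le_0_iff)
  moreover have "{x \<in> space M. \<not> x \<notin> N} \<subseteq> (\<Inter>k. V k)" using V(2) by blast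
  ultimately show ?thesis by (rule AE_I')
qed

lemma AE_measure_ball_pos:
  fixes \<mu> :: "'a::{metric_space, second_countable_topology} measure"
  assumes "finite_measure \<mu>" and sets: "sets \<mu> = sets borel"
  shows "AE z in \<mu>. \<forall>r>0. 0 < measure \<mu> (ball z r)"
proof -
  interpret finite_measure \<mu> by fact
  let ?\<N> = "{ball z r | z r. measure \<mu> (ball z r) = 0}"
  obtain \<H> where \<H>: "\<H> \<subseteq> ?\<N>" "countable \<H>" "\<Union>\<H> = \<Union>?\<N>"
    by (rule Lindelof[of ?\<N>]) auto
  have "\<Union>\<H> \<in> null_sets \<mu>"
  proof (rule null_sets_UN'[OF \<H>(2), of "\<lambda>X. X", simplified])
    fix X assume "X \<in> \<H>"
    with \<H>(1) show "X \<in> null_sets \<mu>" by (auto simp: null_sets_def sets emeasure_eq_measure)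
  qed
  then show ?thesis
  proof (rule AE_I')
    show "{z \<in> space \<mu>. \<not> (\<forall>r>0. 0 < measure \<mu> (ball z r))} \<subseteq> \<Union>\<H>"
      unfolding \<H>(3) by (force simp: zero_less_measure_iff)
  qed
qed

lemma ball_measure_eventually_le_if_null:
  fixes m \<rho> :: "real measure"
  assumes "finite_measure m" "finite_measure \<rho>" and sets: "sets m = sets borel" "sets \<rho> = sets borel"
    and A: "A \<in> sets borel" "emeasure \<rho> A = 0" and "0 < t"
  shows "AE y in m. y \<in> A \<longrightarrow> (\<forall>\<^sub>F s in at_right 0. measure \<rho> (ball y s) \<le> t * measure m (ball y s))"
proof -
  interpret m: finite_measure m by fact
  interpret \<rho>: finite_measure \<rho> by fact
  let ?light = "\<lambda>y. \<forall>\<^sub>F s in at_right 0. measure \<rho> (ball y s) \<le> t * measure m (ball y s)"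
  have "AE y in m. y \<notin> {y \<in> A. \<not> ?light y}"
  proof (rule m.AE_notin_if_small_covers)
    fix e :: real assume "0 < e"
    then have "emeasure \<rho> A < ennreal (t * e / 2)" using A \<open>0 < t\<close> by simp
    then have "(INF U\<in>{U. A \<subseteq> U \<and> open U}. emeasure \<rho> U) < ennreal (t * e / 2)"
      using outer_regular[of \<rho> A] A sets \<rho>.emeasure_finite by simp
    then obtain U where U: "A \<subseteq> U" "open U" "emeasure \<rho> U < ennreal (t * e / 2)"
      by (auto simp: INF_less_iff)
    then have small: "2 * measure \<rho> U < t * e"
      using \<open>0 < t\<close> \<open>0 < e\<close> by (simp add: \<rho>.emeasure_eq_measure ennreal_less_iff)
    let ?V = "maximal_set m \<rho> t U"
    have "t * measure m ?V \<le> 2 * measure \<rho> U"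
      using assms U by (intro measure_maximal_set_le) auto
    with small have "t * measure m ?V \<le> t * e" by linarith
    then have "measure m ?V \<le> e" using \<open>0 < t\<close> by simp
    moreover have "{y \<in> A. \<not> ?light y} \<subseteq> ?V"
      using U(1,2) by (auto simp: frequently_def not_less intro!: maximal_setI_frequently)
    ultimately show "\<exists>V\<in>sets m. {y \<in> A. \<not> ?light y} \<subseteq> V \<and> measure m V \<le> e"
      by (intro bexI[of _ ?V]) (auto simp: sets)
  qed
  then show ?thesis by eventually_elim auto
qed

lemma
  fixes h :: "'a \<Rightarrow> real"
  assumes h: "integrable m h" and nonneg: "\<And>x. 0 \<le> h x"
  shows finite_measure_density_integrable: "finite_measure (density m h)"
    and measure_density_eq_set_integral: "B \<in> sets m \<Longrightarrow> measure (density m h) B = (LINT x:B|m. h x)"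
proof -
  note [measurable] = borel_measurable_integrable[OF h]
  have "emeasure (density m h) (space m) = (\<integral>\<^sup>+x. h x \<partial>m)"
    by (subst emeasure_density) (auto intro!: nn_integral_cong)
  also have "\<dots> < \<infinity>" using h nonneg by (simp add: nn_integral_eq_integral)
  finally show "finite_measure (density m h)" by (intro finite_measureI) simp
  assume B [measurable]: "B \<in> sets m"
  have "measure (density m h) B = (\<integral>x. indicator B x \<partial>density m h)"
    using sets.sets_into_space[OF B] by (simp add: Int_absorb2)
  also have "\<dots> = (\<integral>x. h x *\<^sub>R indicator B x \<partial>m)"
    by (rule integral_density) (auto simp: nonneg)
  finally show "measure (density m h) B = (LINT x:B|m. h x)"
    by (simp add: set_lebesgue_integral_def mult.commute)
qed

lemma (in finite_measure) set_integral_le_density_excess: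
  assumes h: "integrable M h" and B: "B \<in> sets M"
  shows "(LINT x:B|M. h x) \<le> q * measure M B + measure (density M (\<lambda>x. max 0 (h x - q))) B"
proof -
  let ?k = "\<lambda>x. max 0 (h x - q)"
  have k: "integrable M ?k" using h by (auto intro!: Bochner_Integration.integrable_max)
  have set_integrable: "set_integrable M B h" "set_integrable M B ?k" "set_integrable M B (\<lambda>x. q)"
    unfolding set_integrable_def by (intro integrable_mult_indicator B h k integrable_const)+
  have "(LINT x:B|M. h x) \<le> (LINT x:B|M. q + ?k x)"
    by (intro set_integral_mono set_integral_add set_integrable) auto
  also have "\<dots> = (LINT x:B|M. q) + (LINT x:B|M. ?k x)" by (intro set_integral_add set_integrable)
  also have "(LINT x:B|M. q) = q * measure M B"
    using sets.sets_into_space[OF B] by (simp add: set_lebesgue_integral_def mult.commute Int_absorb2)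
  also have "(LINT x:B|M. ?k x) = measure (density M ?k) B"
    by (intro measure_density_eq_set_integral[symmetric] k B) simp
  finally show ?thesis .
qed

lemma ball_set_integral_eventually_le:
  fixes m :: "real measure"
  assumes "finite_measure m" and sets: "sets m = sets borel" and h: "integrable m h" and "q < q'"
  shows "AE y in m. h y \<le> q \<longrightarrow>
    (\<forall>\<^sub>F s in at_right 0. (LINT x:ball y s|m. h x) \<le> q' * measure m (ball y s))"
proof -
  interpret m: finite_measure m by fact
  have [measurable_cong]: "sets m = sets borel" by fact
  note [measurable] = borel_measurable_integrable[OF h]
  have [simp]: "space m = UNIV" using sets_eq_imp_space_eq[OF sets] by simp
  let ?\<rho> = "density m (\<lambda>x. max 0 (h x - q))"
  have "integrable m (\<lambda>x. max 0 (h x - q))" using h by (auto intro!: Bochner_Integration.integrable_max)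
  then have "finite_measure ?\<rho>" by (rule finite_measure_density_integrable) simp
  moreover have "{y. h y \<le> q} \<in> sets borel" by measurable
  moreover have "emeasure ?\<rho> {y. h y \<le> q} = 0"
    by (subst emeasure_density) (auto simp: nn_integral_0_iff_AE indicator_def ennreal_neg)
  ultimately have "AE y in m. y \<in> {y. h y \<le> q} \<longrightarrow>
      (\<forall>\<^sub>F s in at_right 0. measure ?\<rho> (ball y s) \<le> (q' - q) * measure m (ball y s))"
    using assms by (intro ball_measure_eventually_le_if_null) auto
  then show ?thesis
  proof (eventually_elim, intro impI)
    fix y assume "y \<in> {y. h y \<le> q} \<longrightarrow>
      (\<forall>\<^sub>F s in at_right 0. measure ?\<rho> (ball y s) \<le> (q' - q) * measure m (ball y s))" and "h y \<le> q"
    then have "\<forall>\<^sub>F s in at_right 0. measure ?\<rho> (ball y s) \<le> (q' - q) * measure m (ball y s)" by simp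
    then show "\<forall>\<^sub>F s in at_right 0. (LINT x:ball y s|m. h x) \<le> q' * measure m (ball y s)"
    proof eventually_elim
      case (elim s)
      have "(LINT x:ball y s|m. h x) \<le> q * measure m (ball y s) + measure ?\<rho> (ball y s)"
        by (rule m.set_integral_le_density_excess[OF h]) (simp add: sets)
      with elim show ?case by (simp add: algebra_simps)
    qed
  qed
qed

lemma ball_average_eventually_less:
  fixes m :: "real measure"
  assumes "finite_measure m" "sets m = sets borel" "integrable m h"
  shows "AE y in m. \<forall>a>h y. \<forall>\<^sub>F s in at_right 0. (LINT x:ball y s|m. h x) / measure m (ball y s) < a"
proof -
  have "AE y in m. \<forall>q q'::rat. q < q' \<longrightarrow> h y \<le> real_of_rat q \<longrightarrow>
      (\<forall>\<^sub>F s in at_right 0. (LINT x:ball y s|m. h x) \<le> real_of_rat q' * measure m (ball y s))"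
    unfolding AE_all_countable
    by (intro allI AE_impI ball_set_integral_eventually_le assms) (simp add: of_rat_less)
  with AE_measure_ball_pos[OF assms(1,2)] show ?thesis
  proof (eventually_elim, intro allI impI)
    fix y a assume pos: "\<forall>r>0. 0 < measure m (ball y r)" and "h y < a"
      and eventually_le: "\<forall>q q'::rat. q < q' \<longrightarrow> h y \<le> real_of_rat q \<longrightarrow>
        (\<forall>\<^sub>F s in at_right 0. (LINT x:ball y s|m. h x) \<le> real_of_rat q' * measure m (ball y s))"
    obtain q' where q': "h y < real_of_rat q'" "real_of_rat q' < a"
      using of_rat_dense[OF \<open>h y < a\<close>] by blast
    obtain q where q: "h y < real_of_rat q" "real_of_rat q < real_of_rat q'"
      using of_rat_dense[OF q'(1)] by blast
    have "\<forall>\<^sub>F s in at_right 0. (LINT x:ball y s|m. h x) \<le> real_of_rat q' * measure m (ball y s)"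
      using eventually_le q by (auto simp: of_rat_less)
    with eventually_at_right_less[of 0]
    show "\<forall>\<^sub>F s in at_right 0. (LINT x:ball y s|m. h x) / measure m (ball y s) < a"
    proof eventually_elim
      case (elim s)
      then have "(LINT x:ball y s|m. h x) / measure m (ball y s) \<le> real_of_rat q'"
        using pos by (simp add: pos_divide_le_eq)
      with q'(2) show ?case by linarith
    qed
  qed
qed

theorem lebesgue_differentiation_real:
  fixes m :: "real measure"
  assumes "finite_measure m" "sets m = sets borel" and h: "integrable m h"
  shows "AE y in m. ((\<lambda>s. (LINT x:ball y s|m. h x) / measure m (ball y s)) \<longlongrightarrow> h y) (at_right 0)"
proof -
  have "integrable m (\<lambda>x. - h x)" using h by simp
  from ball_average_eventually_less[OF assms] ball_average_eventually_less[OF assms(1,2) this]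
  show ?thesis
  proof eventually_elim
    case (elim y)
    have neg: "(LINT x:B|m. - h x) = - (LINT x:B|m. h x)" for B
      by (simp add: set_lebesgue_integral_def)
    show ?case
    proof (rule order_tendstoI)
      fix a assume "a < h y"
      then show "\<forall>\<^sub>F s in at_right 0. a < (LINT x:ball y s|m. h x) / measure m (ball y s)"
        using elim(2)[rule_format, of "- a"] by (simp add: neg)
    qed (use elim(1) in blast)
  qed
qed

corollary ball_ratio_tendsto_RN_deriv:
  fixes m \<mu> :: "real measure"
  assumes "finite_measure m" "finite_measure \<mu>" and sets: "sets m = sets borel" "sets \<mu> = sets borel"
    and ac: "absolutely_continuous m \<mu>"
  shows "AE y in m. ((\<lambda>s. measure \<mu> (ball y s) / measure m (ball y s))
    \<longlongrightarrow> enn2real (RN_deriv m \<mu> y)) (at_right 0)"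
proof -
  interpret m: finite_measure m by fact
  interpret \<mu>: finite_measure \<mu> by fact
  define h where "h y = enn2real (RN_deriv m \<mu> y)" for y
  have [measurable]: "h \<in> borel_measurable m" by (simp add: h_def[abs_def])
  have "AE y in m. RN_deriv m \<mu> y \<noteq> \<infinity>"
    using ac sets by (intro m.RN_deriv_finite \<mu>.sigma_finite_measure_axioms) auto
  then have "density m h = density m (RN_deriv m \<mu>)"
    by (intro density_cong) (auto simp: h_def less_top elim!: eventually_mono)
  also have "\<dots> = \<mu>" using ac sets by (intro m.density_RN_deriv) auto
  finally have dens: "density m h = \<mu>" .
  have "(\<integral>\<^sup>+y. h y \<partial>m) = emeasure \<mu> (space m)"
    unfolding dens[symmetric] by (subst emeasure_density) (auto intro!: nn_integral_cong)
  then have h: "integrable m h"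
    by (intro integrableI_nonneg) (auto simp: h_def less_top[symmetric])
  have "0 \<le> h y" for y by (simp add: h_def)
  from measure_density_eq_set_integral[OF h this]
  have "measure \<mu> (ball y s) = (LINT x:ball y s|m. h x)" for y s using sets by (simp add: dens)
  then show ?thesis
    using lebesgue_differentiation_real[OF assms(1) sets(1) h] by (simp add: h_def)
qed

lemma ball_measure_ge_linear_if_notin_maximal_set:
  fixes m :: "real measure"
  assumes "0 < t" "\<bar>y\<bar> < N" and notin: "y \<notin> maximal_set m (uniform_measure lborel {- N..N}) t UNIV"
  shows "\<forall>\<^sub>F s in at_right 0. 1 / (t * N) * s \<le> measure m (ball y s)"
proof -
  have "0 < N" using assms(2) by linarith
  have "\<forall>\<^sub>F s in at_right 0. s \<in> {0<..<N - \<bar>y\<bar>}" using assms(2) by (intro eventually_at_right_real) simp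
  then show ?thesis
  proof eventually_elim
    case s: (elim s)
    then have "{- N..N} \<inter> ball y s = {y - s<..<y + s}" by (auto simp: dist_real_def)
    then have "s / N = measure (uniform_measure lborel {- N..N}) (ball y s)"
      using s \<open>0 < N\<close> by (subst measure_uniform_measure) auto
    also have "\<dots> < t * measure m (ball y s)"
      using notin s maximal_setI[of t m y s "uniform_measure lborel {- N..N}" UNIV] by force
    finally show ?case using \<open>0 < t\<close> \<open>0 < N\<close> by (simp add: field_simps)
  qed
qed

lemma AE_ball_measure_ge_linear:
  fixes m :: "real measure"
  assumes "finite_measure m" and sets: "sets m = sets borel"
  shows "AE y in m. \<exists>c>0. \<forall>\<^sub>F s in at_right 0. c * s \<le> measure m (ball y s)"
proof -
  interpret m: finite_measure m by fact
  let ?linear = "\<lambda>y. \<exists>c>0. \<forall>\<^sub>F s in at_right 0. c * s \<le> measure m (ball y s)"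
  have "AE y in m. y \<notin> {y. \<bar>y\<bar> < real (Suc n) \<and> \<not> ?linear y}" for n
  proof (rule m.AE_notin_if_small_covers)
    fix e :: real assume "0 < e"
    define N where "N = real (Suc n)"
    have "0 < N" by (simp add: N_def)
    let ?\<mu> = "uniform_measure lborel {- N..N}"
    let ?V = "maximal_set m ?\<mu> (2 / e) UNIV"
    interpret \<mu>: prob_space ?\<mu> using \<open>0 < N\<close> by (intro prob_space_uniform_measure) auto
    have "2 / e * measure m ?V \<le> 2 * measure ?\<mu> UNIV"
      using \<open>0 < e\<close> sets
      by (intro measure_maximal_set_le m.finite_measure_axioms \<mu>.finite_measure_axioms) auto
    then have "measure m ?V \<le> e" using \<mu>.prob_space \<open>0 < e\<close> by (simp add: field_simps)
    moreover have "?linear y" if "\<bar>y\<bar> < N" "y \<notin> ?V" for y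
      using ball_measure_ge_linear_if_notin_maximal_set[OF _ that] \<open>0 < e\<close> \<open>0 < N\<close>
      by (intro exI[of _ "1 / (2 / e * N)"]) simp
    ultimately show "\<exists>V\<in>sets m. {y. \<bar>y\<bar> < real (Suc n) \<and> \<not> ?linear y} \<subseteq> V \<and> measure m V \<le> e"
      by (intro bexI[of _ ?V]) (auto simp: N_def sets)
  qed
  then have "AE y in m. \<forall>n. y \<notin> {y. \<bar>y\<bar> < real (Suc n) \<and> \<not> ?linear y}" unfolding AE_all_countable by blast
  then show ?thesis
  proof eventually_elim
    case (elim y)
    obtain n where "\<bar>y\<bar> < real n" using reals_Archimedean2 by blast
    then have "\<bar>y\<bar> < real (Suc n)" by simp
    with elim show ?case by blast
  qed
qed

section \<open>Exact dimensionality\<close>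

definition has_exponent :: "(real \<Rightarrow> real) \<Rightarrow> real \<Rightarrow> bool" where
  "has_exponent a d \<longleftrightarrow> ((\<lambda>r. ln (a r) / ln r) \<longlongrightarrow> d) (at_right 0)"

lemma exact_dimensional_iff_has_exponent:
  "exact_dimensional \<mu> d \<longleftrightarrow> (AE z in \<mu>. has_exponent (\<lambda>r. measure \<mu> (ball z r)) d)"
  by (simp add: exact_dimensional_def has_exponent_def)

lemma has_exponent_linear: "0 < c \<Longrightarrow> has_exponent (\<lambda>r. c * r) 1"
  unfolding has_exponent_def by real_asymp

lemma has_exponent_mult:
  assumes "has_exponent a d" "has_exponent b e"
    and pos: "\<And>r. 0 < r \<Longrightarrow> 0 < a r" "\<And>r. 0 < r \<Longrightarrow> 0 < b r"
  shows "has_exponent (\<lambda>r. a r * b r) (d + e)"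
  unfolding has_exponent_def
proof (rule Lim_transform_eventually)
  show "((\<lambda>r. ln (a r) / ln r + ln (b r) / ln r) \<longlongrightarrow> d + e) (at_right 0)"
    using assms(1,2) unfolding has_exponent_def by (rule tendsto_add)
  show "\<forall>\<^sub>F r in at_right 0. ln (a r) / ln r + ln (b r) / ln r = ln (a r * b r) / ln r"
    using eventually_at_right_less[of 0]
    by eventually_elim (simp add: ln_mult_pos pos add_divide_distrib)
qed

lemma has_exponent_rescale:
  assumes "has_exponent a d" and "0 < c"
  shows "has_exponent (\<lambda>r. a (c * r)) d"
  unfolding has_exponent_def
proof (rule Lim_transform_eventually)
  have "filterlim (\<lambda>r. c * r) (at_right 0) (at_right 0)" using \<open>0 < c\<close> by real_asymp
  with assms(1) have "((\<lambda>r. ln (a (c * r)) / ln (c * r)) \<longlongrightarrow> d) (at_right 0)"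
    unfolding has_exponent_def by (rule filterlim_compose)
  moreover have "((\<lambda>r. ln (c * r) / ln r) \<longlongrightarrow> 1) (at_right 0)" using \<open>0 < c\<close> by real_asymp
  ultimately have "((\<lambda>r. ln (a (c * r)) / ln (c * r) * (ln (c * r) / ln r)) \<longlongrightarrow> d * 1) (at_right 0)"
    by (rule tendsto_mult)
  then show "((\<lambda>r. ln (a (c * r)) / ln (c * r) * (ln (c * r) / ln r)) \<longlongrightarrow> d) (at_right 0)" by simp
  have "\<forall>\<^sub>F r in at_right 0. ln (c * r) < 0" using \<open>0 < c\<close> by real_asymp
  then show "\<forall>\<^sub>F r in at_right 0. ln (a (c * r)) / ln (c * r) * (ln (c * r) / ln r) = ln (a (c * r)) / ln r"
    by eventually_elim simp
qed

lemma ln_ratio_antimono: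
  fixes a b r :: real
  assumes "0 < a" "a \<le> b" "0 < r" "r < 1"
  shows "ln b / ln r \<le> ln a / ln r"
  using assms by (intro divide_right_mono_neg) auto

lemma has_exponent_sandwich:
  assumes "has_exponent a d" "has_exponent b d"
    and between: "\<forall>\<^sub>F r in at_right 0. 0 < a r \<and> a r \<le> w r \<and> w r \<le> b r"
  shows "has_exponent w d"
  unfolding has_exponent_def
proof (rule tendsto_sandwich)
  have small: "\<forall>\<^sub>F r in at_right (0::real). r \<in> {0<..<1}" by (rule eventually_at_right_real) simp
  show "\<forall>\<^sub>F r in at_right 0. ln (b r) / ln r \<le> ln (w r) / ln r"
    using between small by eventually_elim (auto intro!: ln_ratio_antimono)
  show "\<forall>\<^sub>F r in at_right 0. ln (w r) / ln r \<le> ln (a r) / ln r"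
    using between small by eventually_elim (auto intro!: ln_ratio_antimono)
qed (use assms in \<open>simp_all add: has_exponent_def\<close>)

lemma has_exponent_le:
  assumes "has_exponent a d" "has_exponent b e"
    and eventually_le: "\<forall>\<^sub>F r in at_right 0. 0 < a r \<and> a r \<le> b r"
  shows "e \<le> d"
proof (rule tendsto_le)
  have small: "\<forall>\<^sub>F r in at_right (0::real). r \<in> {0<..<1}" by (rule eventually_at_right_real) simp
  show "\<forall>\<^sub>F r in at_right 0. ln (b r) / ln r \<le> ln (a r) / ln r"
    using eventually_le small by eventually_elim (auto intro!: ln_ratio_antimono)
qed (use assms in \<open>simp_all add: has_exponent_def\<close>)

definition scale_index :: "real \<Rightarrow> real \<Rightarrow> real \<Rightarrow> nat" where
  "scale_index R \<gamma> r = nat \<lfloor>(ln R - ln r) / (- ln \<gamma>)\<rfloor>"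

lemma scale_index_bounds:
  assumes \<gamma>: "0 < \<gamma>" "\<gamma> < 1" and r: "0 < r" "r \<le> R"
  shows "R * \<gamma> ^ Suc (scale_index R \<gamma> r) \<le> r" "r \<le> R * \<gamma> ^ scale_index R \<gamma> r"
proof -
  let ?N = "scale_index R \<gamma> r"
  have "0 < R" using r by linarith
  have ln_neg: "0 < - ln \<gamma>" using \<gamma> by simp
  have "0 \<le> (ln R - ln r) / (- ln \<gamma>)" using r ln_neg by (intro divide_nonneg_pos) auto
  then have "real ?N \<le> (ln R - ln r) / (- ln \<gamma>)" "(ln R - ln r) / (- ln \<gamma>) < real (Suc ?N)"
    unfolding scale_index_def by linarith+
  then have "real ?N * (- ln \<gamma>) \<le> ln R - ln r" "ln R - ln r \<le> real (Suc ?N) * (- ln \<gamma>)"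
    using ln_neg by (simp_all only: pos_le_divide_eq pos_divide_less_eq less_imp_le)
  moreover have "ln (R * \<gamma> ^ n) = ln R + real n * ln \<gamma>" for n
    using \<open>0 < R\<close> \<gamma> by (simp add: ln_mult_pos ln_realpow)
  ultimately have "ln (R * \<gamma> ^ Suc ?N) \<le> ln r" "ln r \<le> ln (R * \<gamma> ^ ?N)" by (simp_all only: mult_minus_right)
  then show "R * \<gamma> ^ Suc ?N \<le> r" "r \<le> R * \<gamma> ^ ?N" using r \<open>0 < R\<close> \<gamma> by simp_all
qed

lemma
  assumes \<gamma>: "0 < \<gamma>" "\<gamma> < 1"
  shows scale_index_at_top: "filterlim (\<lambda>r. scale_index R \<gamma> r + c) at_top (at_right 0)"
    and scale_index_over_ln: "((\<lambda>r. real (scale_index R \<gamma> r + c) / - ln r) \<longlongrightarrow> 1 / - ln \<gamma>) (at_right 0)"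
proof -
  have ln_neg: "0 < - ln \<gamma>" using \<gamma> by simp
  show "filterlim (\<lambda>r. scale_index R \<gamma> r + c) at_top (at_right 0)"
    unfolding scale_index_def using ln_neg by real_asymp
  have "((\<lambda>r. real (scale_index R \<gamma> r + c) / - ln r) \<longlongrightarrow> inverse (- ln \<gamma>)) (at_right 0)"
    unfolding scale_index_def using ln_neg by real_asymp
  then show "((\<lambda>r. real (scale_index R \<gamma> r + c) / - ln r) \<longlongrightarrow> 1 / - ln \<gamma>) (at_right 0)"
    by (simp add: inverse_eq_divide)
qed

lemma ln_ratio_along_scale_index:
  assumes \<gamma>: "0 < \<gamma>" "\<gamma> < 1" and lim: "(\<lambda>n. - ln (a (R * \<gamma> ^ n)) / n) \<longlonglongrightarrow> h"
  shows "((\<lambda>r. ln (a (R * \<gamma> ^ (scale_index R \<gamma> r + c))) / ln r) \<longlongrightarrow> h / - ln \<gamma>) (at_right 0)"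
proof (rule Lim_transform_eventually)
  let ?N = "\<lambda>r. scale_index R \<gamma> r + c"
  have "((\<lambda>r. - ln (a (R * \<gamma> ^ ?N r)) / real (?N r) * (real (?N r) / - ln r))
      \<longlongrightarrow> h * (1 / - ln \<gamma>)) (at_right 0)"
    by (intro tendsto_mult scale_index_over_ln filterlim_compose[OF lim scale_index_at_top] \<gamma>)
  then show "((\<lambda>r. - ln (a (R * \<gamma> ^ ?N r)) / real (?N r) * (real (?N r) / - ln r))
      \<longlongrightarrow> h / - ln \<gamma>) (at_right 0)"
    by simp
  have "\<forall>\<^sub>F r in at_right 0. 1 \<le> ?N r" using scale_index_at_top[OF \<gamma>] by (simp add: filterlim_at_top)
  then show "\<forall>\<^sub>F r in at_right 0. - ln (a (R * \<gamma> ^ ?N r)) / real (?N r) * (real (?N r) / - ln r)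
      = ln (a (R * \<gamma> ^ ?N r)) / ln r"
    by eventually_elim (simp del: of_nat_add)
qed

lemma has_exponent_if_along_powers:
  fixes a :: "real \<Rightarrow> real"
  assumes mono: "\<And>r s. 0 < r \<Longrightarrow> r \<le> s \<Longrightarrow> a r \<le> a s" and pos: "\<And>r. 0 < r \<Longrightarrow> 0 < a r"
    and R: "0 < R" and \<gamma>: "0 < \<gamma>" "\<gamma> < 1"
    and lim: "(\<lambda>n. - ln (a (R * \<gamma> ^ n)) / n) \<longlonglongrightarrow> h"
  shows "has_exponent a (h / (- ln \<gamma>))"
  unfolding has_exponent_def
proof (rule tendsto_sandwich)
  let ?N = "scale_index R \<gamma>"
  show "((\<lambda>r. ln (a (R * \<gamma> ^ (?N r + 0))) / ln r) \<longlongrightarrow> h / (- ln \<gamma>)) (at_right 0)"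
    "((\<lambda>r. ln (a (R * \<gamma> ^ (?N r + 1))) / ln r) \<longlongrightarrow> h / (- ln \<gamma>)) (at_right 0)"
    by (rule ln_ratio_along_scale_index[OF \<gamma> lim])+
  have small: "\<forall>\<^sub>F r in at_right 0. r \<in> {0<..<min R 1}" using R by (intro eventually_at_right_real) simp
  show "\<forall>\<^sub>F r in at_right 0. ln (a (R * \<gamma> ^ (?N r + 0))) / ln r \<le> ln (a r) / ln r"
    using small
  proof eventually_elim
    case (elim r)
    then show ?case
      using scale_index_bounds(2)[OF \<gamma>, of r R] by (intro ln_ratio_antimono pos mono) auto
  qed
  show "\<forall>\<^sub>F r in at_right 0. ln (a r) / ln r \<le> ln (a (R * \<gamma> ^ (?N r + 1))) / ln r"
    using small
  proof eventually_elim
    case (elim r)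
    then show ?case
      using scale_index_bounds(1)[OF \<gamma>, of r R] R \<gamma> by (intro ln_ratio_antimono pos mono) auto
  qed
qed

lemma powers_at_right_0:
  fixes R \<gamma> :: real
  assumes "0 < R" "0 < \<gamma>" "\<gamma> < 1"
  shows "filterlim (\<lambda>n. R * \<gamma> ^ n) (at_right 0) sequentially"
  using assms by real_asymp

lemma has_exponent_along_powers:
  assumes "has_exponent a d" "0 < R" "0 < \<gamma>" "\<gamma> < 1"
  shows "(\<lambda>n. - ln (a (R * \<gamma> ^ n)) / n) \<longlonglongrightarrow> d * (- ln \<gamma>)"
proof (rule Lim_transform_eventually)
  have "(\<lambda>n. ln (a (R * \<gamma> ^ n)) / ln (R * \<gamma> ^ n)) \<longlonglongrightarrow> d"
    using assms(1) unfolding has_exponent_def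
    by (rule filterlim_compose[OF _ powers_at_right_0[OF assms(2-4)]])
  moreover have "(\<lambda>n. - ln (R * \<gamma> ^ n) / n) \<longlonglongrightarrow> - ln \<gamma>" using assms(2-4) by real_asymp
  ultimately show "(\<lambda>n. ln (a (R * \<gamma> ^ n)) / ln (R * \<gamma> ^ n) * (- ln (R * \<gamma> ^ n) / n)) \<longlonglongrightarrow> d * (- ln \<gamma>)"
    by (rule tendsto_mult)
  have "\<forall>\<^sub>F n in sequentially. ln (R * \<gamma> ^ n) < 0" using assms(2-4) by real_asymp
  then show "\<forall>\<^sub>F n in sequentially. ln (a (R * \<gamma> ^ n)) / ln (R * \<gamma> ^ n) * (- ln (R * \<gamma> ^ n) / n)
      = - ln (a (R * \<gamma> ^ n)) / n"
    by eventually_elim simp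
qed

lemma borel_measurable_measure_ball:
  fixes \<mu> :: "'a::{metric_space, second_countable_topology} measure"
  assumes "finite_measure \<mu>" and sets: "sets \<mu> = sets borel"
  shows "(\<lambda>z. measure \<mu> (ball z r)) \<in> borel_measurable borel"
proof -
  interpret finite_measure \<mu> by fact
  have "open {p::'a \<times> 'a. dist (fst p) (snd p) < r}"
    by (intro open_Collect_less continuous_intros)
  then have "{p::'a \<times> 'a. dist (fst p) (snd p) < r} \<in> sets (borel \<Otimes>\<^sub>M borel)"
    unfolding borel_prod by auto
  also have "sets (borel \<Otimes>\<^sub>M borel :: ('a \<times> 'a) measure) = sets (borel \<Otimes>\<^sub>M \<mu>)"
    by (intro sets_pair_measure_cong) (simp_all add: sets)
  finally have "(\<lambda>z. emeasure \<mu> (Pair z -` {p. dist (fst p) (snd p) < r})) \<in> borel_measurable borel"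
    by (rule measurable_emeasure_Pair)
  moreover have "Pair z -` {p. dist (fst p) (snd p) < r} = ball z r" for z :: 'a by auto
  ultimately show ?thesis by (simp add: measure_def)
qed

text \<open>The set of points with a given local dimension is not obviously measurable, but up to a null set it
  is described by the radii \<open>2\<^sup>-\<^sup>n\<close> alone.\<close>

lemma exact_dimensional_distrI:
  fixes f :: "'b \<Rightarrow> 'a::{metric_space, second_countable_topology}"
  assumes "prob_space M" and f [measurable]: "f \<in> borel_measurable M"
    and exponent: "AE \<omega> in M. has_exponent (\<lambda>r. measure (distr M borel f) (ball (f \<omega>) r)) d"
  shows "exact_dimensional (distr M borel f) d"
proof -
  let ?\<nu> = "distr M borel f"
  interpret \<nu>: prob_space ?\<nu> using assms(1) f by (rule prob_space.prob_space_distr)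
  have [measurable]: "(\<lambda>z. measure ?\<nu> (ball z r)) \<in> borel_measurable borel" for r
    by (intro borel_measurable_measure_ball) (auto intro: \<nu>.finite_measure_axioms)
  define Q where "Q = {z. (\<lambda>n. - ln (measure ?\<nu> (ball z (1 * (1/2) ^ n))) / n) \<longlonglongrightarrow> d * (- ln (1/2))}"
  have "Q \<in> sets borel"
    unfolding Q_def tendsto_iff_dist_less_inverse_Suc eventually_sequentially by measurable
  moreover have "AE \<omega> in M. f \<omega> \<in> Q"
    using exponent
  proof eventually_elim
    case (elim \<omega>)
    then show ?case unfolding Q_def by (intro CollectI has_exponent_along_powers) simp_all
  qed
  ultimately have "AE z in ?\<nu>. z \<in> Q" by (subst AE_distr_iff) auto
  moreover have "AE z in ?\<nu>. \<forall>r>0. 0 < measure ?\<nu> (ball z r)"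
    by (intro AE_measure_ball_pos \<nu>.finite_measure_axioms) simp
  ultimately show ?thesis unfolding exact_dimensional_iff_has_exponent
  proof eventually_elim
    case (elim z)
    have "has_exponent (\<lambda>r. measure ?\<nu> (ball z r)) (d * (- ln (1/2)) / (- ln (1/2)))"
    proof (rule has_exponent_if_along_powers[where R=1])
      show "\<nu>.prob (ball z r) \<le> \<nu>.prob (ball z s)" if "r \<le> s" for r s
        using that by (intro \<nu>.finite_measure_mono subset_ball) simp_all
      show "(\<lambda>n. - ln (\<nu>.prob (ball z (1 * (1/2) ^ n))) / n) \<longlonglongrightarrow> d * (- ln (1/2))"
        using elim(1) unfolding Q_def by (rule CollectD)
    qed (use elim(2) in auto)
    then show ?case by simp
  qed
qed

lemma exact_dimensional_nonneg:
  fixes \<mu> :: "'a::{metric_space, second_countable_topology} measure"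
  assumes "prob_space \<mu>" and sets: "sets \<mu> = sets borel" and "exact_dimensional \<mu> d"
  shows "0 \<le> d"
proof -
  interpret prob_space \<mu> by fact
  have "AE z in \<mu>. has_exponent (\<lambda>r. prob (ball z r)) d"
    using assms(3) by (simp add: exact_dimensional_iff_has_exponent)
  with AE_measure_ball_pos[OF finite_measure_axioms sets] have "AE z in \<mu>. 0 \<le> d"
  proof eventually_elim
    case (elim z)
    have "\<forall>\<^sub>F r in at_right 0. 0 < prob (ball z r) \<and> prob (ball z r) \<le> 1"
      using eventually_at_right_less[of 0] by eventually_elim (use elim(1) in auto)
    moreover have "has_exponent (\<lambda>r. 1) 0" by (simp add: has_exponent_def)
    ultimately show ?case using has_exponent_le elim(2) by blast
  qed
  then show ?thesis by simp
qed

lemma exact_dimensional_real_le_1: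
  fixes \<mu> :: "real measure"
  assumes "prob_space \<mu>" and sets: "sets \<mu> = sets borel" and "exact_dimensional \<mu> d"
  shows "d \<le> 1"
proof -
  interpret prob_space \<mu> by fact
  have "AE z in \<mu>. has_exponent (\<lambda>r. prob (ball z r)) d"
    using assms(3) by (simp add: exact_dimensional_iff_has_exponent)
  with AE_ball_measure_ge_linear[OF finite_measure_axioms sets] have "AE z in \<mu>. d \<le> 1"
  proof eventually_elim
    case (elim z)
    then obtain c where "0 < c" and linear: "\<forall>\<^sub>F r in at_right 0. c * r \<le> prob (ball z r)" by blast
    have "\<forall>\<^sub>F r in at_right 0. 0 < c * r \<and> c * r \<le> prob (ball z r)"
      using linear eventually_at_right_less[of 0] by eventually_elim (use \<open>0 < c\<close> in auto)
    then show ?case using has_exponent_le[OF has_exponent_linear[OF \<open>0 < c\<close>] elim(2)] by blast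
  qed
  then show ?thesis by simp
qed

section \<open>A criterion for ergodicity\<close>

context prob_space
begin

lemma abs_prob_diff_le_sym_diff:
  assumes "A \<in> events" "B \<in> events"
  shows "\<bar>prob A - prob B\<bar> \<le> prob (sym_diff A B)"
proof -
  have prob_le: "prob X \<le> prob Y + prob (sym_diff X Y)" if "X \<in> events" "Y \<in> events" for X Y
  proof -
    have "prob X \<le> prob (Y \<union> sym_diff X Y)" using that by (intro finite_measure_mono) auto
    also have "\<dots> \<le> prob Y + prob (sym_diff X Y)" using that by (intro measure_Un_le) auto
    finally show ?thesis .
  qed
  from prob_le[OF assms] prob_le[OF assms(2,1)] show ?thesis by (simp add: Un_commute abs_le_iff)
qed

lemma prob_sym_diff_triangle:
  assumes "A \<in> events" "B \<in> events" "C \<in> events"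
  shows "prob (sym_diff A C) \<le> prob (sym_diff A B) + prob (sym_diff B C)"
proof -
  have "prob (sym_diff A C) \<le> prob (sym_diff A B \<union> sym_diff B C)"
    using assms by (intro finite_measure_mono) auto
  also have "\<dots> \<le> prob (sym_diff A B) + prob (sym_diff B C)"
    using assms by (intro measure_Un_le) auto
  finally show ?thesis .
qed

lemma prob_sym_diff_Un_le:
  assumes "A \<in> events" "B \<in> events" "A' \<in> events" "B' \<in> events"
  shows "prob (sym_diff (A \<union> B) (A' \<union> B')) \<le> prob (sym_diff A A') + prob (sym_diff B B')"
proof -
  have "prob (sym_diff (A \<union> B) (A' \<union> B')) \<le> prob (sym_diff A A' \<union> sym_diff B B')"
    using assms by (intro finite_measure_mono) auto
  also have "\<dots> \<le> prob (sym_diff A A') + prob (sym_diff B B')"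
    using assms by (intro measure_Un_le) auto
  finally show ?thesis .
qed

definition approximable :: "'a set set \<Rightarrow> 'a set \<Rightarrow> bool" where
  "approximable \<A> B \<longleftrightarrow> (\<forall>e>0. \<exists>A\<in>\<A>. prob (sym_diff A B) < e)"

lemma approximable_mem: "A \<in> \<A> \<Longrightarrow> approximable \<A> A"
  unfolding approximable_def by (intro allI impI bexI[of _ A]) auto

lemma approximable_Compl:
  assumes "algebra (space M) \<A>" and B: "B \<subseteq> space M" "approximable \<A> B"
  shows "approximable \<A> (space M - B)"
  unfolding approximable_def
proof (intro allI impI)
  interpret \<A>: algebra "space M" \<A> by fact
  fix e :: real assume "0 < e"
  then obtain A where A: "A \<in> \<A>" "prob (sym_diff A B) < e" using B(2) by (auto simp: approximable_def)
  moreover have "sym_diff (space M - A) (space M - B) = sym_diff A B"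
    using B(1) A(1) \<A>.space_closed by blast
  ultimately show "\<exists>A\<in>\<A>. prob (sym_diff A (space M - B)) < e"
    by (intro bexI[of _ "space M - A"]) auto
qed

lemma approximable_finite_UN:
  assumes "algebra (space M) \<A>" and sub: "\<A> \<subseteq> events"
    and B: "\<And>i. B i \<in> events" "\<And>i. approximable \<A> (B i)"
  shows "approximable \<A> (\<Union>i<n::nat. B i)"
proof (induction n)
  case 0
  interpret \<A>: algebra "space M" \<A> by fact
  show ?case by (simp add: approximable_mem)
next
  case (Suc n)
  interpret \<A>: algebra "space M" \<A> by fact
  show ?case unfolding approximable_def
  proof (intro allI impI)
    fix e :: real assume "0 < e"
    then have "0 < e / 2" by simp
    then obtain A A' where A: "A \<in> \<A>" "prob (sym_diff A (\<Union>i<n. B i)) < e / 2"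
      and A': "A' \<in> \<A>" "prob (sym_diff A' (B n)) < e / 2"
      using Suc B(2) unfolding approximable_def by metis
    have "prob (sym_diff (A \<union> A') (\<Union>i<Suc n. B i)) = prob (sym_diff (A \<union> A') ((\<Union>i<n. B i) \<union> B n))"
      by (simp add: lessThan_Suc Un_commute)
    also have "\<dots> \<le> prob (sym_diff A (\<Union>i<n. B i)) + prob (sym_diff A' (B n))"
      using sub A(1) A'(1) B(1) by (intro prob_sym_diff_Un_le) auto
    also have "\<dots> < e" using A(2) A'(2) by simp
    finally show "\<exists>A\<in>\<A>. prob (sym_diff A (\<Union>i<Suc n. B i)) < e" using A(1) A'(1) by blast
  qed
qed

lemma approximable_UN:
  assumes "algebra (space M) \<A>" and sub: "\<A> \<subseteq> events"
    and B: "\<And>i. B i \<in> events" "\<And>i. approximable \<A> (B i)"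
  shows "approximable \<A> (\<Union>i::nat. B i)"
  unfolding approximable_def
proof (intro allI impI)
  fix e :: real assume "0 < e"
  let ?W = "\<Union>i. B i" and ?V = "\<lambda>n. \<Union>i<n. B i"
  have "(\<lambda>n. prob (?V n)) \<longlonglongrightarrow> prob (\<Union>n. ?V n)"
    using B(1) by (intro finite_Lim_measure_incseq incseq_SucI UN_mono) auto
  moreover have "(\<Union>n. ?V n) = ?W" by auto
  ultimately have "\<forall>\<^sub>F n in sequentially. prob ?W - e / 2 < prob (?V n)"
    using \<open>0 < e\<close> by (intro order_tendstoD(1)) auto
  then obtain n where n: "prob ?W - e / 2 < prob (?V n)" by (auto simp: eventually_sequentially)
  have "sym_diff (?V n) ?W = ?W - ?V n" by auto
  moreover have "prob (?W - ?V n) = prob ?W - prob (?V n)"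
    using B(1) by (intro finite_measure_Diff) auto
  ultimately have near: "prob (sym_diff (?V n) ?W) < e / 2" using n by simp
  have "approximable \<A> (?V n)" by (rule approximable_finite_UN[OF assms])
  then obtain A where A: "A \<in> \<A>" "prob (sym_diff A (?V n)) < e / 2"
    using \<open>0 < e\<close> unfolding approximable_def by (meson half_gt_zero)
  have "A \<in> events" using sub A(1) by blast
  moreover have "?V n \<in> events" "?W \<in> events" using B(1) by (simp_all add: sets.countable_UN'')
  ultimately have "prob (sym_diff A ?W) \<le> prob (sym_diff A (?V n)) + prob (sym_diff (?V n) ?W)"
    by (rule prob_sym_diff_triangle)
  also have "\<dots> < e" using A(2) near by simp
  finally show "\<exists>A\<in>\<A>. prob (sym_diff A ?W) < e" using A(1) by blast
qed

lemma approximable_sigma_sets: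
  assumes alg: "algebra (space M) \<A>" and sub: "\<A> \<subseteq> events" and B: "B \<in> sigma_sets (space M) \<A>"
  shows "approximable \<A> B"
  using B
proof induction
  interpret \<A>: algebra "space M" \<A> by fact
  {
    case (Basic A)
    then show ?case by (rule approximable_mem)
  next
    case Empty
    show ?case by (simp add: approximable_mem)
  next
    case (Compl B)
    then show ?case using sigma_sets_into_sp[OF \<A>.space_closed] by (intro approximable_Compl alg) auto
  next
    case (Union B)
    then show ?case using sets.sigma_sets_subset[OF sub] by (intro approximable_UN alg sub) auto
  }
qed

end

lemma (in measure_preserving) vimage_funpow_invariant:
  assumes A: "A \<in> events" and inv: "T -` A \<inter> space M = A"
  shows "(T ^^ n) -` A \<inter> space M = A"
proof (induction n)
  case 0
  show ?case using sets.sets_into_space[OF A] by auto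
next
  case (Suc n)
  have "(T ^^ Suc n) -` A \<inter> space M = (T ^^ n) -` (T -` A \<inter> space M) \<inter> space M"
    using measurable_space[OF funpow_measurable, of _ n] by auto
  then show ?case by (simp only: inv Suc)
qed

lemma (in measure_preserving) abs_prob_diff_Int_preimage_le:
  assumes A: "A \<in> events" and C: "C \<in> events"
  shows "\<bar>prob (C \<inter> ((T ^^ n) -` C \<inter> space M)) - prob (A \<inter> ((T ^^ n) -` A \<inter> space M))\<bar>
    \<le> 2 * prob (sym_diff C A)"
proof -
  let ?pre = "\<lambda>X. (T ^^ n) -` X \<inter> space M"
  note [measurable] = A C
  have "\<bar>prob (C \<inter> ?pre C) - prob (A \<inter> ?pre A)\<bar> \<le> prob (sym_diff (C \<inter> ?pre C) (A \<inter> ?pre A))"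
    by (intro abs_prob_diff_le_sym_diff) measurable
  also have "\<dots> \<le> prob (sym_diff C A \<union> ?pre (sym_diff C A))" by (intro finite_measure_mono) auto
  also have "\<dots> \<le> prob (sym_diff C A) + prob (?pre (sym_diff C A))" by (intro measure_Un_le) auto
  also have "prob (?pre (sym_diff C A)) = prob (sym_diff C A)" by (rule prob_vimage_funpow) simp
  finally show ?thesis by simp
qed

text \<open>Approximating an invariant set \<open>A\<close> by a set \<open>C\<close> that is independent of one of its preimages gives
  \<open>prob A = (prob A)\<^sup>2\<close>.\<close>

lemma (in measure_preserving) ergodic_systemI:
  assumes alg: "algebra (space M) \<A>" and sub: "\<A> \<subseteq> events" and gen: "events \<subseteq> sigma_sets (space M) \<A>"
    and indep: "\<And>C. C \<in> \<A> \<Longrightarrow> \<exists>n. prob (C \<inter> (T ^^ n) -` C) = prob C * prob C"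
  shows "ergodic_system M T"
proof (intro ergodic_system.intro ergodic_system_axioms.intro measure_preserving_axioms)
  fix A assume A: "A \<in> events" and inv: "T -` A \<inter> space M = A"
  have "\<bar>prob A - prob A * prob A\<bar> \<le> 0 + e" if "0 < e" for e
  proof -
    have "approximable \<A> A" using gen A by (intro approximable_sigma_sets alg sub) auto
    then obtain C where C: "C \<in> \<A>" and near: "prob (sym_diff C A) < e / 4"
      using \<open>0 < e\<close> unfolding approximable_def by (metis zero_less_divide_iff zero_less_numeral)
    have C_event [measurable]: "C \<in> events" using sub C by blast
    obtain n where n: "prob (C \<inter> (T ^^ n) -` C) = prob C * prob C" using indep[OF C] by blast
    let ?pre = "\<lambda>X. (T ^^ n) -` X \<inter> space M"
    have "\<bar>prob (C \<inter> ?pre C) - prob (A \<inter> ?pre A)\<bar> < e / 2"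
      using abs_prob_diff_Int_preimage_le[OF A C_event, of n] near by linarith
    moreover have "C \<inter> ?pre C = C \<inter> (T ^^ n) -` C" using sets.sets_into_space[OF C_event] by auto
    then have "prob (C \<inter> ?pre C) = prob C * prob C" using n by simp
    moreover have "prob (A \<inter> ?pre A) = prob A" by (simp only: vimage_funpow_invariant[OF A inv] Int_absorb)
    moreover have "\<bar>prob C * prob C - prob A * prob A\<bar> \<le> e / 2"
    proof -
      have "\<bar>prob C * prob C - prob A * prob A\<bar> = \<bar>prob C - prob A\<bar> * (prob C + prob A)"
        unfolding square_diff_square_factored abs_mult by simp
      also have "\<dots> \<le> e / 4 * 2"
      proof (rule mult_mono)
        show "\<bar>prob C - prob A\<bar> \<le> e / 4"
          using abs_prob_diff_le_sym_diff[OF C_event A] near by linarith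
        show "prob C + prob A \<le> 2" using prob_le_1[of C] prob_le_1[of A] by linarith
      qed (use \<open>0 < e\<close> in auto)
      finally show ?thesis by simp
    qed
    ultimately show ?thesis by linarith
  qed
  then have "\<bar>prob A - prob A * prob A\<bar> \<le> 0" by (rule field_le_epsilon)
  then have "prob A * (1 - prob A) = 0" by (simp add: algebra_simps)
  then show "prob A = 0 \<or> prob A = 1" by auto
qed

section \<open>The inverse baker's transformation in base \<open>b\<close>\<close>

lemma sets_Int_vimage:
  assumes "A \<in> sets M" "f \<in> measurable M N" "B \<in> sets N"
  shows "A \<inter> f -` B \<in> sets M"
proof -
  have "A \<inter> f -` B = A \<inter> (f -` B \<inter> space M)" using sets.sets_into_space[OF assms(1)] by auto
  then show ?thesis using assms by (simp add: measurable_sets sets.Int)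
qed

lemma (in sequence_space) measurable_suffix: "(\<lambda>\<omega> i. \<omega> (i + k)) \<in> measurable S S"
proof (rule measurable_PiM_single')
  show "(\<lambda>\<omega>. \<omega> (i + k)) \<in> measurable S M" for i by (rule measurable_component_singleton) simp
qed (auto simp: space_PiM PiE_iff)

lemma (in sequence_space) emeasure_prefix_Int_suffix:
  assumes A: "A \<in> sets S" and B: "B \<in> sets S"
    and prefix: "\<And>\<omega> \<omega>'. \<omega> \<in> A \<Longrightarrow> \<omega>' \<in> space S \<Longrightarrow> (\<And>i. i < k \<Longrightarrow> \<omega> i = \<omega>' i) \<Longrightarrow> \<omega>' \<in> A"
  shows "emeasure S (A \<inter> (\<lambda>\<omega> i. \<omega> (i + k)) -` B) = emeasure S A * emeasure S B"
proof -
  let ?X = "A \<inter> (\<lambda>\<omega> i. \<omega> (i + k)) -` B" and ?comb = "\<lambda>(\<omega>, \<omega>'). comb_seq k \<omega> \<omega>'"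
  note subsets = sets.sets_into_space[OF A] sets.sets_into_space[OF B]
  have X: "?X \<in> sets S" by (intro sets_Int_vimage[OF A measurable_suffix B])
  have comb_space: "comb_seq k \<omega> \<omega>' \<in> space S" if "\<omega> \<in> space S" "\<omega>' \<in> space S" for \<omega> \<omega>'
    using that by (auto simp: space_PiM PiE_def Pi_def comb_seq_def)
  have mem_X: "comb_seq k \<omega> \<omega>' \<in> ?X \<longleftrightarrow> \<omega> \<in> A \<and> \<omega>' \<in> B" if "\<omega> \<in> space S" "\<omega>' \<in> space S" for \<omega> \<omega>'
    using prefix[of "comb_seq k \<omega> \<omega>'" \<omega>] prefix[of \<omega> "comb_seq k \<omega> \<omega>'"] that comb_space[OF that]
    by (auto simp: comb_seq_less comb_seq_add)
  have vimage: "?comb -` ?X \<inter> space (S \<Otimes>\<^sub>M S) = A \<times> B"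
  proof (rule set_eqI)
    fix z show "z \<in> ?comb -` ?X \<inter> space (S \<Otimes>\<^sub>M S) \<longleftrightarrow> z \<in> A \<times> B"
      using mem_X[of "fst z" "snd z"] subsets by (cases z) (auto simp: space_pair_measure)
  qed
  have "emeasure S ?X = emeasure (distr (S \<Otimes>\<^sub>M S) S ?comb) ?X" by (simp only: PiM_comb_seq)
  also have "\<dots> = emeasure (S \<Otimes>\<^sub>M S) (A \<times> B)"
    unfolding vimage[symmetric] by (intro emeasure_distr measurable_comb_seq X)
  also have "\<dots> = emeasure S A * emeasure S B" by (intro P.emeasure_pair_measure_Times A B)
  finally show ?thesis .
qed

lemma sum_emeasure_consecutive_intervals:
  fixes f :: "nat \<Rightarrow> 'a::linorder_topology"
  assumes "mono f" and sets: "sets M = sets borel" and A: "A \<in> sets borel"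
  shows "(\<Sum>i<n. emeasure M ({f i..<f (Suc i)} \<inter> A)) = emeasure M ({f 0..<f n} \<inter> A)"
proof (induction n)
  case (Suc n)
  have "f 0 \<le> f n" "f n \<le> f (Suc n)" using \<open>mono f\<close> by (auto simp: mono_def)
  then have "{f 0..<f (Suc n)} \<inter> A = ({f 0..<f n} \<inter> A) \<union> ({f n..<f (Suc n)} \<inter> A)" by auto
  also have "emeasure M \<dots> = emeasure M ({f 0..<f n} \<inter> A) + emeasure M ({f n..<f (Suc n)} \<inter> A)"
    by (intro plus_emeasure[symmetric]) (use A in \<open>auto simp: sets\<close>)
  finally show ?case using Suc by simp
qed simp

locale digit_system =
  fixes b :: nat
  assumes b_ge_2: "b \<ge> 2"
begin

abbreviation "D \<equiv> digit_measure b"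
abbreviation "\<U> \<equiv> uniform_measure lborel {0..<1::real}"
abbreviation "P \<equiv> \<U> \<Otimes>\<^sub>M D"

lemma b_pos: "0 < real b"
  using b_ge_2 by simp

lemma prob_space_digit: "prob_space (uniform_count_measure {0..<b})"
  using b_ge_2 by (intro prob_space_uniform_count_measure) auto

sublocale seq: sequence_space "uniform_count_measure {0..<b}"
  using prob_space_digit
  by (auto simp: sequence_space_def product_prob_space_def product_prob_space_axioms_def
      product_sigma_finite_def intro: prob_space_imp_sigma_finite)

sublocale D: prob_space "digit_measure b"
  unfolding digit_measure_def by (rule seq.P.prob_space_axioms)

sublocale U: prob_space "uniform_measure lborel {0..<1::real}"
  by (rule prob_space_uniform_measure) auto

sublocale UD: pair_prob_space "uniform_measure lborel {0..<1::real}" "digit_measure b" ..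

definition shift :: "(nat \<Rightarrow> nat) \<Rightarrow> nat \<Rightarrow> nat" where
  "shift j = (\<lambda>k. j (Suc k))"

definition baker :: "real \<times> (nat \<Rightarrow> nat) \<Rightarrow> real \<times> (nat \<Rightarrow> nat)" where
  "baker p = ((fst p + real (snd p 0)) / real b, shift (snd p))"

lemma space_D: "space D = {j. \<forall>k. j k < b}"
  by (auto simp: digit_measure_def space_PiM space_uniform_count_measure PiE_def Pi_def)

lemma space_P: "space P = UNIV \<times> space D"
  by (simp add: space_pair_measure)

lemma digit_measurable: "(\<lambda>j. j k) \<in> measurable D (count_space {0..<b})"
proof -
  have "(\<lambda>j. j k) \<in> measurable D (uniform_count_measure {0..<b})"
    unfolding digit_measure_def by (rule measurable_component_singleton) simp
  also have "\<dots> = measurable D (count_space {0..<b})"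
    by (rule measurable_cong_sets[OF refl sets_uniform_count_measure_count_space])
  finally show ?thesis .
qed

lemma digit_real_measurable [measurable]: "(\<lambda>j. real (j k)) \<in> borel_measurable D"
  using measurable_compose[OF digit_measurable, of real borel k] by simp

lemma digit_pred_measurable [measurable]: "Measurable.pred D (\<lambda>j. j k = i)"
proof -
  have "Measurable.pred D (\<lambda>j. real (j k) = real i)" by measurable
  then show ?thesis by simp
qed

lemma shift_measurable [measurable]: "shift \<in> measurable D D"
  using seq.measurable_suffix[of 1] unfolding digit_measure_def shift_def[abs_def] by simp

lemma measurable_U_iff: "measurable N \<U> = borel_measurable N"
  by (rule measurable_cong_sets) simp_all

lemma fst_P_measurable [measurable]: "fst \<in> borel_measurable P"
  using measurable_fst[of \<U> D] by (simp only: measurable_U_iff)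

lemma baker_measurable [measurable]: "baker \<in> measurable P P"
proof -
  have [measurable]: "(\<lambda>p. real (snd p 0)) \<in> borel_measurable P"
    using measurable_compose[OF measurable_snd digit_real_measurable] .
  have "(\<lambda>p. (fst p + real (snd p 0)) / real b) \<in> measurable P \<U>"
    unfolding measurable_U_iff by measurable
  then show ?thesis unfolding baker_def
    by (intro measurable_Pair measurable_compose[OF measurable_snd shift_measurable])
qed

lemma emeasure_digit_cylinder:
  assumes "i < b" and B: "B \<in> sets D"
  shows "emeasure D {j\<in>space D. j 0 = i \<and> shift j \<in> B} = emeasure D B / ennreal b"
proof -
  let ?A = "{j\<in>space D. j 0 = i}"
  have "emeasure D (?A \<inter> (\<lambda>j n. j (n + 1)) -` B) = emeasure D ?A * emeasure D B"
    using B unfolding digit_measure_def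
    by (intro seq.emeasure_prefix_Int_suffix) (auto simp flip: digit_measure_def)
  also have "emeasure D ?A = emeasure (uniform_count_measure {0..<b}) {i}"
    unfolding digit_measure_def using \<open>i < b\<close> seq.emeasure_PiM_Collect_single[of 0 "{i}"]
    by (simp add: sets_uniform_count_measure)
  also have "\<dots> = ennreal (1 / b)" using \<open>i < b\<close> by (simp add: emeasure_uniform_count_measure)
  also have "?A \<inter> (\<lambda>j n. j (n + 1)) -` B = {j\<in>space D. j 0 = i \<and> shift j \<in> B}" by (auto simp: shift_def)
  finally show ?thesis using b_pos
    by (simp add: divide_ennreal_def inverse_ennreal mult.commute divide_inverse)
qed

lemma emeasure_U: "A \<in> sets borel \<Longrightarrow> emeasure \<U> A = emeasure lborel ({0..<1} \<inter> A)"
  by (simp add: divide_ennreal_def)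

lemma AE_U_unit: "AE x in \<U>. 0 \<le> x \<and> x < 1"
  by (rule AE_uniform_measureI) auto

lemma emeasure_U_branch:
  assumes [measurable]: "A \<in> sets borel"
  shows "emeasure \<U> {x. (x + real i) / b \<in> A} = b * emeasure lborel ({i / b..<Suc i / b} \<inter> A)"
proof -
  let ?X = "{i / b..<Suc i / b} \<inter> A"
  have branch: "i / b + 1 / b * x \<in> ?X \<longleftrightarrow> x \<in> {0..<1} \<inter> {x. (x + real i) / b \<in> A}" for x :: real
    using b_pos by (auto simp: field_simps)
  have "emeasure lborel ?X = (\<integral>\<^sup>+x. indicator ?X x \<partial>lborel)" by simp
  also have "\<dots> = ennreal (1 / b) * (\<integral>\<^sup>+x. indicator ?X (i / b + 1 / b * x) \<partial>lborel)"
    using b_pos by (subst nn_integral_real_affine[of _ "1 / b" "i / b"]) auto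
  also have "(\<integral>\<^sup>+x. indicator ?X (i / b + 1 / b * x) \<partial>lborel)
      = (\<integral>\<^sup>+x. indicator ({0..<1} \<inter> {x. (x + real i) / b \<in> A}) x \<partial>lborel)"
    by (intro nn_integral_cong) (simp only: indicator_def branch)
  also have "\<dots> = emeasure \<U> {x. (x + real i) / b \<in> A}"
    by (subst emeasure_U) auto
  finally have "ennreal b * emeasure lborel ?X
      = (ennreal b * ennreal (1 / b)) * emeasure \<U> {x. (x + real i) / b \<in> A}"
    by (simp add: mult.assoc)
  also have "ennreal b * ennreal (1 / b) = 1" using b_pos by (simp add: ennreal_mult''[symmetric])
  finally show ?thesis by (simp add: ennreal_of_nat_eq_real_of_nat)
qed

lemma emeasure_U_self_similar:
  assumes A: "A \<in> sets borel"
  shows "emeasure \<U> A = (\<Sum>i<b. emeasure \<U> {x. (x + real i) / b \<in> A}) / ennreal b"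
proof -
  have "mono (\<lambda>i. real i / b)" using b_pos by (auto simp: mono_def divide_right_mono)
  from sum_emeasure_consecutive_intervals[OF this sets_lborel A, of b]
  have "emeasure \<U> A = (\<Sum>i<b. emeasure lborel ({i / b..<Suc i / b} \<inter> A))"
    using b_pos by (simp add: emeasure_U[OF A])
  moreover have "(\<Sum>i<b. emeasure \<U> {x. (x + real i) / b \<in> A})
      = ennreal b * (\<Sum>i<b. emeasure lborel ({i / b..<Suc i / b} \<inter> A))"
    by (simp only: emeasure_U_branch[OF A] sum_distrib_left ennreal_of_nat_eq_real_of_nat)
  ultimately show ?thesis using b_pos by (simp add: mult.commute[of "ennreal b"] ennreal_mult_divide_eq)
qed

lemma distr_baker: "distr P P baker = P"
proof (rule sym, rule pair_measure_eqI)
  show "sigma_finite_measure \<U>" "sigma_finite_measure D" by unfold_locales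
  fix A B assume "A \<in> sets \<U>" and B [measurable]: "B \<in> sets D"
  then have A [measurable]: "A \<in> sets borel" by simp
  let ?A = "\<lambda>i. {x. (x + real i) / b \<in> A}" and ?B = "\<lambda>i. {j\<in>space D. j 0 = i \<and> shift j \<in> B}"
  have sA: "?A i \<in> sets \<U>" and sB: "?B i \<in> sets D" for i by auto
  have "emeasure (distr P P baker) (A \<times> B) = emeasure P (baker -` (A \<times> B) \<inter> space P)"
    by (intro emeasure_distr) auto
  also have "baker -` (A \<times> B) \<inter> space P = (\<Union>i<b. ?A i \<times> ?B i)"
    using sets.sets_into_space[OF B] by (auto simp: space_P baker_def space_D)
  also have "emeasure P \<dots> = (\<Sum>i<b. emeasure P (?A i \<times> ?B i))"
    using sA sB by (intro sum_emeasure[symmetric]) (auto simp: disjoint_family_on_def)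
  also have "\<dots> = (\<Sum>i<b. emeasure \<U> (?A i) * (emeasure D B / ennreal b))"
    by (intro sum.cong refl)
       (simp only: D.emeasure_pair_measure_Times[OF sA sB] emeasure_digit_cylinder[OF _ B] lessThan_iff)
  also have "\<dots> = (\<Sum>i<b. emeasure \<U> (?A i)) * (emeasure D B / ennreal b)"
    by (rule sum_distrib_right[symmetric])
  also have "\<dots> = (\<Sum>i<b. emeasure \<U> (?A i)) / ennreal b * emeasure D B"
    by (simp only: divide_ennreal_def mult_ac)
  also have "\<dots> = emeasure \<U> A * emeasure D B" by (simp only: emeasure_U_self_similar[OF A, symmetric])
  finally show "emeasure \<U> A * emeasure D B = emeasure (distr P P baker) (A \<times> B)" by simp
qed simp

sublocale baker: measure_preserving P baker
  by (intro measure_preserving.intro measure_preserving_axioms.intro UD.prob_space_axioms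
      baker_measurable distr_baker)

lemma baker_space: "\<omega> \<in> space P \<Longrightarrow> baker \<omega> \<in> space P"
  using measurable_space[OF baker_measurable] .

lemma baker_funpow:
  "(baker ^^ n) (x, j) = ((x + (\<Sum>i<n. real (j i) * real b ^ i)) / real b ^ n, \<lambda>i. j (i + n))"
proof (induction n)
  case (Suc n)
  have "(x + (\<Sum>i<n. real (j i) * real b ^ i)) / real b ^ n + real (j n)
      = (x + (\<Sum>i<Suc n. real (j i) * real b ^ i)) / real b ^ n"
    using b_pos by (simp add: field_simps)
  moreover have "(baker ^^ Suc n) (x, j) = baker ((baker ^^ n) (x, j))" by simp
  ultimately show ?case unfolding Suc baker_def shift_def by simp
qed simp

definition prefix_code :: "nat \<Rightarrow> real \<times> (nat \<Rightarrow> nat) \<Rightarrow> int \<times> nat list" where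
  "prefix_code k p = (\<lfloor>real b ^ k * fst p\<rfloor>, map (snd p) [0..<k])"

definition cylinders :: "(real \<times> (nat \<Rightarrow> nat)) set set" where
  "cylinders = (\<Union>k. range (\<lambda>X. prefix_code k -` X \<inter> space P))"

lemma prefix_code_measurable [measurable]: "prefix_code k \<in> measurable P (count_space UNIV)"
  unfolding measurable_count_space_eq_countable[OF countableI_type]
proof (intro conjI ballI)
  fix c :: "int \<times> nat list"
  have [measurable]: "Measurable.pred P (\<lambda>p. snd p i = d)" for i d
    using measurable_compose[OF measurable_snd digit_pred_measurable] .
  have "prefix_code k p = c \<longleftrightarrow>
      \<lfloor>real b ^ k * fst p\<rfloor> = fst c \<and> length (snd c) = k \<and> (\<forall>i<k. snd p i = snd c ! i)" for p
    by (cases c) (auto simp: prefix_code_def list_eq_iff_nth_eq)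
  then have "prefix_code k -` {c} \<inter> space P
      = {p \<in> space P. \<lfloor>real b ^ k * fst p\<rfloor> = fst c \<and> length (snd c) = k \<and> (\<forall>i<k. snd p i = snd c ! i)}"
    by blast
  also have "\<dots> \<in> sets P" by measurable
  finally show "prefix_code k -` {c} \<inter> space P \<in> sets P" .
qed simp

lemma cylindersI: "prefix_code k -` X \<inter> space P \<in> cylinders"
  unfolding cylinders_def by (intro UN_I[of k] UNIV_I rangeI)

lemma cylindersE:
  assumes "A \<in> cylinders"
  obtains k X where "A = prefix_code k -` X \<inter> space P"
  using assms unfolding cylinders_def by blast

lemma cylinders_sets: "cylinders \<subseteq> sets P"
proof
  fix A assume "A \<in> cylinders"
  then obtain k X where "A = prefix_code k -` X \<inter> space P" by (rule cylindersE)
  then show "A \<in> sets P" using measurable_sets[OF prefix_code_measurable, of X k] by simp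
qed

lemma prefix_code_coarser:
  assumes "k \<le> l"
  shows "prefix_code k p = map_prod (\<lambda>z. z div int (b ^ (l - k))) (take k) (prefix_code l p)"
proof -
  have "real b ^ l = real b ^ k * real b ^ (l - k)" using assms by (simp flip: power_add)
  then have "real b ^ k * fst p = real b ^ l * fst p / of_int (int (b ^ (l - k)))" using b_pos by simp
  then have "\<lfloor>real b ^ k * fst p\<rfloor> = \<lfloor>real b ^ l * fst p\<rfloor> div int (b ^ (l - k))"
    by (simp only: floor_divide_real_eq_div of_nat_0_le_iff)
  then show ?thesis using assms by (simp add: prefix_code_def take_map)
qed

lemma cylinders_refine:
  assumes "k \<le> l"
  shows "\<exists>Y. prefix_code k -` X \<inter> space P = prefix_code l -` Y \<inter> space P"
  by (intro exI[of _ "map_prod (\<lambda>z. z div int (b ^ (l - k))) (take k) -` X"])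
     (simp only: set_eq_iff Int_iff vimage_eq prefix_code_coarser[OF assms] simp_thms)

lemma algebra_cylinders: "algebra (space P) cylinders"
  unfolding algebra_iff_Un
proof (intro conjI ballI)
  show "cylinders \<subseteq> Pow (space P)" using cylinders_sets sets.sets_into_space by blast
  show "{} \<in> cylinders" using cylindersI[of 0 "{}"] by simp
  fix A assume "A \<in> cylinders"
  then obtain k X where A: "A = prefix_code k -` X \<inter> space P" by (rule cylindersE)
  then have "space P - A = prefix_code k -` (- X) \<inter> space P" by blast
  then show "space P - A \<in> cylinders" by (simp only: cylindersI)
  fix B assume "B \<in> cylinders"
  then obtain l Y where B: "B = prefix_code l -` Y \<inter> space P" by (rule cylindersE)
  obtain X' where "A = prefix_code (max k l) -` X' \<inter> space P"
    using cylinders_refine[of k "max k l" X] A by auto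
  moreover obtain Y' where "B = prefix_code (max k l) -` Y' \<inter> space P"
    using cylinders_refine[of l "max k l" Y] B by auto
  ultimately have "A \<union> B = prefix_code (max k l) -` (X' \<union> Y') \<inter> space P" by blast
  then show "A \<union> B \<in> cylinders" by (simp only: cylindersI)
qed

lemma floor_power_tendsto: "(\<lambda>k. \<lfloor>real b ^ k * x\<rfloor> / real b ^ k) \<longlonglongrightarrow> x"
proof (rule LIM_zero_cancel, rule Lim_null_comparison)
  have "\<bar>\<lfloor>real b ^ k * x\<rfloor> / real b ^ k - x\<bar> \<le> (1 / b) ^ k" for k
  proof -
    have "\<lfloor>real b ^ k * x\<rfloor> / real b ^ k - x = (\<lfloor>real b ^ k * x\<rfloor> - real b ^ k * x) / real b ^ k"
      using b_pos by (simp add: diff_divide_distrib)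
    moreover have "\<bar>\<lfloor>real b ^ k * x\<rfloor> - real b ^ k * x\<bar> \<le> 1" by linarith
    ultimately show ?thesis
      using b_pos by (simp add: abs_divide power_divide divide_right_mono)
  qed
  then show "\<forall>\<^sub>F k in sequentially. norm (\<lfloor>real b ^ k * x\<rfloor> / real b ^ k - x) \<le> (1 / b) ^ k" by simp
  show "(\<lambda>k. (1 / real b) ^ k) \<longlonglongrightarrow> 0" using b_ge_2 by (intro LIMSEQ_realpow_zero) auto
qed

lemma space_sigma_cylinders: "space (sigma (space P) cylinders) = space P"
  and sets_sigma_cylinders: "sets (sigma (space P) cylinders) = sigma_sets (space P) cylinders"
  using algebra_cylinders by (simp_all add: algebra_iff_Un)

lemma prefix_code_measurable_sigma_cylinders [measurable]:
  "prefix_code k \<in> measurable (sigma (space P) cylinders) (count_space UNIV)"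
  by (rule measurableI)
     (simp_all add: space_sigma_cylinders sets_sigma_cylinders sigma_sets.Basic cylindersI)

lemma fst_measurable_sigma_cylinders: "fst \<in> borel_measurable (sigma (space P) cylinders)"
proof (rule borel_measurable_LIMSEQ_real)
  show "(\<lambda>k. of_int (fst (prefix_code k p)) / real b ^ k) \<longlonglongrightarrow> fst p" for p :: "real \<times> (nat \<Rightarrow> nat)"
    by (simp add: prefix_code_def floor_power_tendsto)
qed measurable

lemma snd_measurable_sigma_cylinders: "snd \<in> measurable (sigma (space P) cylinders) D"
proof -
  let ?N = "sigma (space P) cylinders"
  have digit: "(\<lambda>p. snd p i) \<in> measurable ?N (uniform_count_measure {0..<b})" for i
  proof (rule measurableI)
    fix p assume "p \<in> space ?N"
    then show "snd p i \<in> space (uniform_count_measure {0..<b})"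
      unfolding space_sigma_cylinders by (auto simp: space_P space_D space_uniform_count_measure)
  next
    fix X assume "X \<in> sets (uniform_count_measure {0..<b})"
    have "(\<lambda>p. snd (prefix_code (Suc i) p) ! i) \<in> measurable ?N (count_space UNIV)" by measurable
    then have "(\<lambda>p. snd p i) \<in> measurable ?N (count_space UNIV)"
      by (simp add: prefix_code_def nth_append)
    from measurable_sets[OF this, of X] show "(\<lambda>p. snd p i) -` X \<inter> space ?N \<in> sets ?N" by simp
  qed
  have "(\<lambda>p i. snd p i) \<in> space ?N \<rightarrow> (\<Pi>\<^sub>E i\<in>UNIV. space (uniform_count_measure {0..<b}))"
    unfolding space_sigma_cylinders by (auto simp: space_P space_D space_uniform_count_measure)
  from measurable_PiM_single'[OF digit this] show ?thesis unfolding digit_measure_def by simp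
qed

lemma sets_P_subset_sigma_cylinders: "sets P \<subseteq> sigma_sets (space P) cylinders"
proof
  fix A assume A: "A \<in> sets P"
  have "(\<lambda>p. (fst p, snd p)) \<in> measurable (sigma (space P) cylinders) P"
    using fst_measurable_sigma_cylinders snd_measurable_sigma_cylinders
    by (intro measurable_Pair) (simp_all only: measurable_U_iff)
  then have "(\<lambda>p. p) \<in> measurable (sigma (space P) cylinders) P" by simp
  from measurable_sets[OF this A] have "A \<inter> space P \<in> sigma_sets (space P) cylinders"
    by (simp add: space_sigma_cylinders sets_sigma_cylinders)
  then show "A \<in> sigma_sets (space P) cylinders" using sets.sets_into_space[OF A] by (simp add: Int_absorb2)
qed

lemma suffix_P_measurable: "(\<lambda>\<omega> i. snd \<omega> (i + k)) \<in> measurable P D"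
  using measurable_compose[OF measurable_snd seq.measurable_suffix] by (simp add: digit_measure_def)

lemma emeasure_cylinder_Int_suffix:
  assumes B: "B \<in> sets D" and C: "C = prefix_code k -` X \<inter> space P"
  shows "emeasure P (C \<inter> (\<lambda>\<omega> i. snd \<omega> (i + k)) -` B) = emeasure P C * emeasure D B"
proof -
  have Cs: "C \<in> sets P" using cylinders_sets cylindersI C by blast
  let ?E = "C \<inter> (\<lambda>\<omega> i. snd \<omega> (i + k)) -` B"
  have E: "?E \<in> sets P" by (intro sets_Int_vimage[OF Cs suffix_P_measurable B])
  have fibre: "emeasure D (Pair x -` ?E) = emeasure D (Pair x -` C) * emeasure D B" for x
  proof -
    have "emeasure D (Pair x -` C \<inter> (\<lambda>j i. j (i + k)) -` B) = emeasure D (Pair x -` C) * emeasure D B"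
      unfolding digit_measure_def
    proof (rule seq.emeasure_prefix_Int_suffix, unfold digit_measure_def[symmetric])
      show "Pair x -` C \<in> sets D" "B \<in> sets D" using sets_Pair1[OF Cs] B by auto
      fix j j' assume "j \<in> Pair x -` C" "j' \<in> space D" "\<And>i. i < k \<Longrightarrow> j i = j' i"
      moreover from this have "prefix_code k (x, j) = prefix_code k (x, j')" by (simp add: prefix_code_def)
      ultimately show "j' \<in> Pair x -` C" by (simp add: C space_P)
    qed
    moreover have "Pair x -` ?E = Pair x -` C \<inter> (\<lambda>j i. j (i + k)) -` B" by auto
    ultimately show ?thesis by simp
  qed
  have "emeasure P ?E = (\<integral>\<^sup>+x. emeasure D (Pair x -` C) * emeasure D B \<partial>\<U>)"
    by (simp only: D.emeasure_pair_measure_alt[OF E] fibre)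
  also have "\<dots> = (\<integral>\<^sup>+x. emeasure D (Pair x -` C) \<partial>\<U>) * emeasure D B"
    by (intro nn_integral_multc D.measurable_emeasure_Pair Cs)
  also have "(\<integral>\<^sup>+x. emeasure D (Pair x -` C) \<partial>\<U>) = emeasure P C"
    by (rule D.emeasure_pair_measure_alt[OF Cs, symmetric])
  finally show ?thesis .
qed

text \<open>\<open>k\<close> steps of the transformation move the first \<open>k\<close> digits of the sequence into the first \<open>k\<close>
  base-\<open>b\<close> digits of the point.\<close>

lemma prefix_code_baker_funpow:
  assumes "0 \<le> x" "x < 1"
  shows "prefix_code k ((baker ^^ k) (x, j)) = prefix_code k ((baker ^^ k) (0, j))"
proof -
  let ?s = "\<Sum>i<k. j i * b ^ i"
  have "\<lfloor>x + (\<Sum>i<k. real (j i) * real b ^ i)\<rfloor> = int ?s" if "0 \<le> x" "x < 1" for x :: real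
  proof -
    have "x + (\<Sum>i<k. real (j i) * real b ^ i) = x + real ?s" by simp
    then show ?thesis using that by (intro floor_unique) simp_all
  qed
  from this[OF assms] this[of 0] show ?thesis
    using b_pos by (simp add: baker_funpow prefix_code_def)
qed

lemma AE_fst_unit: "AE \<omega> in P. 0 \<le> fst \<omega> \<and> fst \<omega> < 1"
proof (rule UD.AE_pair_measure)
  show "{\<omega>\<in>space P. 0 \<le> fst \<omega> \<and> fst \<omega> < 1} \<in> sets P" by measurable
  show "AE x in \<U>. AE j in D. 0 \<le> fst (x, j) \<and> fst (x, j) < 1" using AE_U_unit by simp
qed

lemma cylinder_baker_funpow:
  assumes C: "C = prefix_code k -` X \<inter> space P"
  obtains B where "B \<in> sets D"
    "\<And>\<omega>. \<omega> \<in> space P \<Longrightarrow> 0 \<le> fst \<omega> \<Longrightarrow> fst \<omega> < 1 \<Longrightarrow> (baker ^^ k) \<omega> \<in> C \<longleftrightarrow> snd \<omega> \<in> B"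
proof
  let ?B = "{j \<in> space D. (baker ^^ k) (0, j) \<in> C}"
  have Cs: "C \<in> sets P" using cylinders_sets cylindersI C by blast
  have "(\<lambda>j. (0, j)) \<in> measurable D P" by (intro measurable_Pair) auto
  then have "(\<lambda>j. (baker ^^ k) (0, j)) \<in> measurable D P"
    by (rule measurable_compose[OF _ baker.funpow_measurable])
  from measurable_sets[OF this Cs] show "?B \<in> sets D" by (simp add: vimage_def Int_def conj_commute)
  fix \<omega> assume \<omega>: "\<omega> \<in> space P" "0 \<le> fst \<omega>" "fst \<omega> < 1"
  have "prefix_code k ((baker ^^ k) \<omega>) = prefix_code k ((baker ^^ k) (0, snd \<omega>))"
    using prefix_code_baker_funpow[OF \<omega>(2,3), of k "snd \<omega>"] by simp
  moreover have "snd \<omega> \<in> space D" "(0, snd \<omega>) \<in> space P" using \<omega>(1) by (auto simp: space_P)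
  ultimately show "(baker ^^ k) \<omega> \<in> C \<longleftrightarrow> snd \<omega> \<in> ?B"
    using \<omega>(1) measurable_space[OF baker.funpow_measurable, of _ k] by (auto simp: C)
qed

lemma cylinder_self_independent:
  assumes "C \<in> cylinders"
  shows "\<exists>n. measure P (C \<inter> (baker ^^ n) -` C) = measure P C * measure P C"
proof -
  obtain k X where C: "C = prefix_code k -` X \<inter> space P" using assms by (rule cylindersE)
  have Cs: "C \<in> sets P" using cylinders_sets assms by blast
  obtain B where B: "B \<in> sets D" and mem_B: "\<And>\<omega>. \<omega> \<in> space P \<Longrightarrow> 0 \<le> fst \<omega> \<Longrightarrow> fst \<omega> < 1 \<Longrightarrow>
      (baker ^^ k) \<omega> \<in> C \<longleftrightarrow> snd \<omega> \<in> B"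
    using cylinder_baker_funpow[OF C] by blast
  have "measure P C = measure P ((baker ^^ k) -` C \<inter> space P)"
    by (rule baker.prob_vimage_funpow[OF Cs, symmetric])
  also have "\<dots> = measure P (UNIV \<times> B)"
  proof (rule measure_eq_AE)
    show "AE \<omega> in P. \<omega> \<in> (baker ^^ k) -` C \<inter> space P \<longleftrightarrow> \<omega> \<in> UNIV \<times> B"
      using AE_fst_unit AE_space by eventually_elim (auto simp: mem_B mem_Times_iff)
    show "(baker ^^ k) -` C \<inter> space P \<in> sets P" by (rule measurable_sets[OF baker.funpow_measurable Cs])
  qed (use B in auto)
  also have "\<dots> = measure D B"
    using B by (simp add: measure_def D.emeasure_pair_measure_Times U.emeasure_space_1[simplified])
  finally have measure_B: "measure D B = measure P C" ..
  have "measure P (C \<inter> (baker ^^ (k + k)) -` C) = measure P (C \<inter> (\<lambda>\<omega> i. snd \<omega> (i + k)) -` B)"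
  proof (rule measure_eq_AE)
    show "AE \<omega> in P. \<omega> \<in> C \<inter> (baker ^^ (k + k)) -` C \<longleftrightarrow> \<omega> \<in> C \<inter> (\<lambda>\<omega> i. snd \<omega> (i + k)) -` B"
      using baker.AE_funpow[OF AE_fst_unit] AE_space
    proof eventually_elim
      case (elim \<omega>)
      have "snd ((baker ^^ k) \<omega>) = (\<lambda>i. snd \<omega> (i + k))"
        using baker_funpow[of k "fst \<omega>" "snd \<omega>"] by simp
      then show ?case
        using mem_B[OF measurable_space[OF baker.funpow_measurable elim(2), of k]] elim(1)
        by (simp add: funpow_add)
    qed
  qed (intro sets_Int_vimage[OF Cs baker.funpow_measurable Cs]
      sets_Int_vimage[OF Cs suffix_P_measurable B])+
  also have "\<dots> = measure P C * measure D B"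
    using emeasure_cylinder_Int_suffix[OF B C] by (simp add: measure_def enn2real_mult)
  finally show ?thesis unfolding measure_B by blast
qed

sublocale baker: ergodic_system P baker
  by (rule baker.ergodic_systemI[OF algebra_cylinders cylinders_sets sets_P_subset_sigma_cylinders
        cylinder_self_independent])

end

section \<open>The skew product\<close>

lemma
  fixes a :: "nat \<Rightarrow> 'a::banach"
  assumes \<gamma>: "0 \<le> \<gamma>" "\<gamma> < 1" and norm_le: "\<And>n. norm (a n) \<le> \<gamma> ^ n * B"
  shows summable_geometric_bound: "summable a"
    and norm_suminf_geometric_bound: "norm (suminf a) \<le> B / (1 - \<gamma>)"
proof -
  have geom: "(\<lambda>n. \<gamma> ^ n * B) sums (B / (1 - \<gamma>))"
    using sums_mult2[OF geometric_sums[of \<gamma>], of B] \<gamma> by simp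
  show "summable a" by (rule summable_comparison_test'[OF sums_summable[OF geom] norm_le])
  show "norm (suminf a) \<le> B / (1 - \<gamma>)"
    using norm_suminf_le[OF norm_le sums_summable[OF geom]] sums_unique[OF geom] by simp
qed

lemma Pair_vimage_ball_subset: "Pair x' -` ball (x, y) r \<subseteq> (if dist x x' < r then ball y r else {})"
proof
  fix z assume "z \<in> Pair x' -` ball (x, y) r"
  then have "dist (x, y) (x', z) < r" by simp
  then show "z \<in> (if dist x x' < r then ball y r else {})"
    using dist_fst_le[of "(x, y)" "(x', z)"] dist_snd_le[of "(x, y)" "(x', z)"] by auto
qed

lemma ball_subset_Pair_vimage_ball:
  assumes "dist x x' + s \<le> r"
  shows "ball y s \<subseteq> Pair x' -` ball (x, y) r"
proof
  fix z assume "z \<in> ball y s"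
  moreover have "dist (x, y) (x', z) \<le> dist x x' + dist y z"
    unfolding dist_Pair_Pair by (rule sqrt_sum_squares_le_sum) simp_all
  ultimately show "z \<in> Pair x' -` ball (x, y) r" using assms by simp
qed

locale skew_product = digit_system b for b :: nat +
  fixes \<gamma> :: real and \<phi> :: "real \<Rightarrow> real" and C :: real
  assumes \<gamma>: "0 < \<gamma>" "\<gamma> < 1"
    and periodic: "\<And>x. \<phi> (x + 1) = \<phi> x"
    and lipschitz: "C-lipschitz_on UNIV \<phi>"
begin

abbreviation S :: "real \<Rightarrow> (nat \<Rightarrow> nat) \<Rightarrow> real" where "S \<equiv> S_fun b \<gamma> \<phi>"
abbreviation m :: "real \<Rightarrow> real measure" where "m \<equiv> m_meas b \<gamma> \<phi>"
abbreviation fibre_point :: "real \<times> (nat \<Rightarrow> nat) \<Rightarrow> real" where "fibre_point \<omega> \<equiv> S (fst \<omega>) (snd \<omega>)"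

definition phi_bound :: real where "phi_bound = \<bar>\<phi> 0\<bar> + C"
definition S_radius :: real where "S_radius = 2 * (phi_bound / (1 - \<gamma>)) + 1"
definition S_lip :: real where "S_lip = C / (1 - \<gamma>)"

lemma C_nonneg: "0 \<le> C"
  using lipschitz by (rule lipschitz_on_nonneg)

lemma S_lip_nonneg: "0 \<le> S_lip"
  using C_nonneg \<gamma> by (simp add: S_lip_def)

lemma phi_lipschitz: "\<bar>\<phi> x - \<phi> y\<bar> \<le> C * \<bar>x - y\<bar>"
  using lipschitz_onD[OF lipschitz, of x y] by (simp add: dist_real_def)

lemma phi_le_bound: "\<bar>\<phi> x\<bar> \<le> phi_bound"
proof -
  interpret periodic_fun_simple' \<phi> by unfold_locales (rule periodic)
  have "\<phi> x = \<phi> (frac x)" unfolding frac_def by (rule minus_of_int[symmetric])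
  moreover have "\<bar>\<phi> (frac x) - \<phi> 0\<bar> \<le> C * 1"
    by (rule order_trans[OF phi_lipschitz mult_left_mono]) (use C_nonneg frac_lt_1[of x] in auto)
  ultimately show ?thesis by (simp add: phi_bound_def)
qed

lemma S_radius_pos: "0 < S_radius"
  using C_nonneg \<gamma> by (simp add: S_radius_def phi_bound_def add_nonneg_pos)

lemma S_term_bound: "norm (\<gamma> ^ n * \<phi> y) \<le> \<gamma> ^ n * phi_bound"
  using \<gamma> phi_le_bound[of y] by (simp add: abs_mult mult_left_mono)

lemma S_summable: "summable (\<lambda>n. \<gamma> ^ n * \<phi> (y n))"
  by (rule summable_geometric_bound[OF _ _ S_term_bound]) (use \<gamma> in auto)

lemma S_bounded: "\<bar>S x j\<bar> \<le> phi_bound / (1 - \<gamma>)"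
  unfolding S_fun_def real_norm_def[symmetric]
  by (rule norm_suminf_geometric_bound[OF _ _ S_term_bound]) (use \<gamma> in auto)

lemma dist_S_less_radius: "dist (S x j) (S x' j') < S_radius"
  using S_bounded[of x j] S_bounded[of x' j'] by (simp add: S_radius_def dist_real_def)

lemma S_rec: "S x j = \<phi> ((x + real (j 0)) / b) + \<gamma> * S ((x + real (j 0)) / b) (shift j)"
proof -
  let ?x = "(x + real (j 0)) / b"
  have arg: "(x + (\<Sum>k\<le>Suc n. real (j k) * real b ^ k)) / real b ^ (Suc n + 1) =
      (?x + (\<Sum>k\<le>n. real (shift j k) * real b ^ k)) / real b ^ (n + 1)" for n
  proof -
    have "(\<Sum>k\<le>Suc n. real (j k) * real b ^ k) = real (j 0) + b * (\<Sum>k\<le>n. real (shift j k) * real b ^ k)"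
      by (subst sum.atMost_Suc_shift) (simp add: shift_def sum_distrib_left mult_ac)
    then have "x + (\<Sum>k\<le>Suc n. real (j k) * real b ^ k) = b * (?x + (\<Sum>k\<le>n. real (shift j k) * real b ^ k))"
      using b_pos by (simp add: field_simps del: sum.atMost_Suc)
    then show ?thesis using b_pos by simp
  qed
  have "S x j = \<phi> ?x
      + (\<Sum>n. \<gamma> ^ Suc n * \<phi> ((x + (\<Sum>k\<le>Suc n. real (j k) * real b ^ k)) / real b ^ (Suc n + 1)))"
    unfolding S_fun_def by (subst suminf_split_head[OF S_summable]) simp
  also have "(\<Sum>n. \<gamma> ^ Suc n * \<phi> ((x + (\<Sum>k\<le>Suc n. real (j k) * real b ^ k)) / real b ^ (Suc n + 1)))
      = \<gamma> * S ?x (shift j)"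
    unfolding S_fun_def arg by (subst suminf_mult[OF S_summable, symmetric]) (simp add: mult_ac)
  finally show ?thesis .
qed

lemma S_lipschitz: "\<bar>S x j - S x' j\<bar> \<le> S_lip * \<bar>x - x'\<bar>"
proof -
  let ?a = "\<lambda>x n. (x + (\<Sum>k\<le>n. real (j k) * real b ^ k)) / real b ^ (n + 1)"
  have "norm (\<gamma> ^ n * \<phi> (?a x n) - \<gamma> ^ n * \<phi> (?a x' n)) \<le> \<gamma> ^ n * (C * \<bar>x - x'\<bar>)" for n
  proof -
    have "1 \<le> real b ^ (n + 1)" using b_ge_2 by (intro one_le_power) simp
    then have "\<bar>x - x'\<bar> / real b ^ (n + 1) \<le> \<bar>x - x'\<bar> / 1" by (intro divide_left_mono) auto
    moreover have "\<bar>?a x n - ?a x' n\<bar> = \<bar>x - x'\<bar> / real b ^ (n + 1)"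
      by (simp add: diff_divide_distrib[symmetric] abs_divide)
    ultimately have "C * \<bar>?a x n - ?a x' n\<bar> \<le> C * \<bar>x - x'\<bar>"
      using C_nonneg by (intro mult_left_mono) auto
    with phi_lipschitz[of "?a x n" "?a x' n"] have "\<bar>\<phi> (?a x n) - \<phi> (?a x' n)\<bar> \<le> C * \<bar>x - x'\<bar>" by linarith
    then show ?thesis
      using \<gamma> by (simp add: right_diff_distrib[symmetric] abs_mult mult_left_mono)
  qed
  then have "norm (\<Sum>n. \<gamma> ^ n * \<phi> (?a x n) - \<gamma> ^ n * \<phi> (?a x' n)) \<le> C * \<bar>x - x'\<bar> / (1 - \<gamma>)"
    using \<gamma> by (intro norm_suminf_geometric_bound) auto
  also have "(\<Sum>n. \<gamma> ^ n * \<phi> (?a x n) - \<gamma> ^ n * \<phi> (?a x' n)) = S x j - S x' j"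
    unfolding S_fun_def by (rule suminf_diff[OF S_summable S_summable, symmetric])
  finally show ?thesis by (simp add: S_lip_def)
qed

lemma S_measurable [measurable (raw)]:
  assumes [measurable]: "f \<in> borel_measurable N" and g: "g \<in> measurable N D"
  shows "(\<lambda>z. S (f z) (g z)) \<in> borel_measurable N"
proof -
  have [measurable]: "\<phi> \<in> borel_measurable borel"
    using lipschitz_on_continuous_on[OF lipschitz] by (rule borel_measurable_continuous_onI)
  have [measurable]: "(\<lambda>z. real (g z k)) \<in> borel_measurable N" for k
    using measurable_compose[OF g digit_real_measurable] .
  show ?thesis unfolding S_fun_def by measurable
qed

lemma Sx_measurable [measurable]: "S x \<in> borel_measurable D"
  using S_measurable[of "\<lambda>_. x" D "\<lambda>j. j"] by simp

lemma fibre_point_measurable [measurable]: "fibre_point \<in> borel_measurable P"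
  by (rule S_measurable[OF fst_P_measurable measurable_snd])

lemma prob_space_m: "prob_space (m x)"
  unfolding m_meas_def by (rule D.prob_space_distr) simp

lemma finite_measure_m: "finite_measure (m x)"
  using prob_space_m by (rule prob_space.finite_measure)

lemma sets_m [simp]: "sets (m x) = sets borel" and space_m [simp]: "space (m x) = UNIV"
  by (simp_all add: m_meas_def)

lemma sets_S_vimage: "B \<in> sets borel \<Longrightarrow> {j\<in>space D. S x j \<in> B} \<in> sets D"
  using measurable_sets[OF Sx_measurable, of B x] by (simp add: vimage_def Int_def conj_commute)

lemma emeasure_m: "B \<in> sets borel \<Longrightarrow> emeasure (m x) B = emeasure D {j\<in>space D. S x j \<in> B}"
  unfolding m_meas_def by (subst emeasure_distr) (auto intro!: arg_cong2[where f=emeasure])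

lemma measure_m: "B \<in> sets borel \<Longrightarrow> measure (m x) B = measure D {j\<in>space D. S x j \<in> B}"
  by (simp add: measure_def emeasure_m)

definition branch_meas :: "real \<Rightarrow> nat \<Rightarrow> real measure" where
  "branch_meas x i = distr (density D (indicator {j\<in>space D. j 0 = i})) borel (S x)"

lemma sets_branch [simp]: "sets (branch_meas x i) = sets borel"
  by (simp add: branch_meas_def)

lemma emeasure_branch:
  assumes [measurable]: "B \<in> sets borel"
  shows "emeasure (branch_meas x i) B = emeasure D {j\<in>space D. j 0 = i \<and> S x j \<in> B}"
proof -
  have "emeasure (branch_meas x i) B
      = emeasure (density D (indicator {j\<in>space D. j 0 = i})) (S x -` B \<inter> space D)"
    unfolding branch_meas_def by (subst emeasure_distr) auto
  also have "\<dots> = emeasure D ({j\<in>space D. j 0 = i} \<inter> (S x -` B \<inter> space D))"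
    by (intro emeasure_restricted) measurable
  also have "{j\<in>space D. j 0 = i} \<inter> (S x -` B \<inter> space D) = {j\<in>space D. j 0 = i \<and> S x j \<in> B}" by auto
  finally show ?thesis .
qed

lemma measure_branch:
  "B \<in> sets borel \<Longrightarrow> measure (branch_meas x i) B = measure D {j\<in>space D. j 0 = i \<and> S x j \<in> B}"
  by (simp add: measure_def emeasure_branch)

lemma finite_measure_branch: "finite_measure (branch_meas x i)"
proof
  have "space (branch_meas x i) = UNIV" by (simp add: branch_meas_def)
  then show "emeasure (branch_meas x i) (space (branch_meas x i)) \<noteq> \<infinity>"
    by (simp add: emeasure_branch)
qed

lemma branch_le_m:
  assumes "B \<in> sets borel"
  shows "measure (branch_meas x i) B \<le> measure (m x) B"
  unfolding measure_branch[OF assms] measure_m[OF assms]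
  using sets_S_vimage[OF assms] by (intro D.finite_measure_mono) auto

lemma absolutely_continuous_branch: "absolutely_continuous (m x) (branch_meas x i)"
  unfolding absolutely_continuous_def
proof
  fix A assume A: "A \<in> null_sets (m x)"
  interpret B: finite_measure "branch_meas x i" by (rule finite_measure_branch)
  have "A \<in> sets borel" using A by (auto simp: null_sets_def)
  moreover from this have "measure (branch_meas x i) A = 0"
    using branch_le_m[of A x i] A by (simp add: measure_eq_0_null_sets measure_le_0_iff)
  ultimately show "A \<in> null_sets (branch_meas x i)" by (simp add: null_sets_def B.emeasure_eq_measure)
qed

lemma measure_branch_ball:
  assumes j: "j \<in> space D"
  shows "measure (branch_meas x (j 0)) (ball (S x j) (\<gamma> * r))
    = measure (m ((x + real (j 0)) / b)) (ball (S ((x + real (j 0)) / b) (shift j)) r) / b"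
proof -
  let ?x = "(x + real (j 0)) / b"
  let ?B = "{k\<in>space D. S ?x k \<in> ball (S ?x (shift j)) r}"
  have "S x k \<in> ball (S x j) (\<gamma> * r) \<longleftrightarrow> S ?x (shift k) \<in> ball (S ?x (shift j)) r" if "k 0 = j 0" for k
  proof -
    have "dist (S x j) (S x k) = \<gamma> * dist (S ?x (shift j)) (S ?x (shift k))"
      using S_rec[of x j] S_rec[of x k] that \<gamma>
      by (simp add: dist_real_def right_diff_distrib[symmetric] abs_mult)
    then show ?thesis using \<gamma> by simp
  qed
  then have "{k\<in>space D. k 0 = j 0 \<and> S x k \<in> ball (S x j) (\<gamma> * r)} = {k\<in>space D. k 0 = j 0 \<and> shift k \<in> ?B}"
    using measurable_space[OF shift_measurable] by auto
  then have "measure (branch_meas x (j 0)) (ball (S x j) (\<gamma> * r))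
      = measure D {k\<in>space D. k 0 = j 0 \<and> shift k \<in> ?B}"
    by (simp add: measure_branch del: mem_ball)
  also have "\<dots> = measure D ?B / b"
    using emeasure_digit_cylinder[of "j 0" ?B] j sets_S_vimage[of "ball (S ?x (shift j)) r" ?x] b_pos
    by (simp add: space_D measure_def divide_ennreal_def enn2real_mult inverse_ennreal divide_inverse
        del: mem_ball)
  also have "measure D ?B = measure (m ?x) (ball (S ?x (shift j)) r)" by (simp add: measure_m del: mem_ball)
  finally show ?thesis .
qed

subsection \<open>Local dimension of the fibre measures\<close>

definition ball_mass :: "nat \<Rightarrow> real \<times> (nat \<Rightarrow> nat) \<Rightarrow> real" where
  "ball_mass n \<omega> = measure (m (fst \<omega>)) (ball (fibre_point \<omega>) (S_radius * \<gamma> ^ n))"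

definition branch_mass :: "nat \<Rightarrow> real \<times> (nat \<Rightarrow> nat) \<Rightarrow> real" where
  "branch_mass n \<omega> = measure (branch_meas (fst \<omega>) (snd \<omega> 0)) (ball (fibre_point \<omega>) (S_radius * \<gamma> ^ n))"

text \<open>The value at \<open>n = 0\<close> is irrelevant: the sums along orbits involve \<open>digit_info (n - k)\<close> for \<open>k < n\<close>
  only.\<close>

definition digit_info :: "nat \<Rightarrow> real \<times> (nat \<Rightarrow> nat) \<Rightarrow> real" where
  "digit_info n \<omega> = (if n = 0 then 0 else ln (ball_mass n \<omega> / branch_mass n \<omega>))"

lemma ball_mass_0: "ball_mass 0 \<omega> = 1"
proof -
  interpret prob_space "m (fst \<omega>)" by (rule prob_space_m)
  have "AE y in m (fst \<omega>). y \<in> ball (fibre_point \<omega>) S_radius"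
    unfolding m_meas_def using dist_S_less_radius by (subst AE_distr_iff) auto
  then show ?thesis by (simp add: ball_mass_def prob_eq_1)
qed

lemma branch_mass_Suc:
  assumes "\<omega> \<in> space P"
  shows "branch_mass (Suc n) \<omega> = ball_mass n (baker \<omega>) / b"
proof -
  have "snd \<omega> \<in> space D" using assms by (auto simp: space_P)
  moreover have "S_radius * \<gamma> ^ Suc n = \<gamma> * (S_radius * \<gamma> ^ n)" by simp
  ultimately show ?thesis
    by (simp only: branch_mass_def ball_mass_def baker_def measure_branch_ball fst_conv snd_conv)
qed

lemma branch_mass_le_ball_mass: "branch_mass n \<omega> \<le> ball_mass n \<omega>"
  unfolding ball_mass_def branch_mass_def by (rule branch_le_m) simp

lemma ball_mass_pos: "\<omega> \<in> space P \<Longrightarrow> 0 < ball_mass n \<omega>"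
proof (induction n arbitrary: \<omega>)
  case (Suc n)
  have "0 < branch_mass (Suc n) \<omega>"
    using Suc.IH[OF baker_space[OF Suc.prems]] b_pos by (simp add: branch_mass_Suc[OF Suc.prems])
  then show ?case using branch_mass_le_ball_mass[of "Suc n" \<omega>] by linarith
qed (simp add: ball_mass_0)

lemma branch_mass_pos: "\<omega> \<in> space P \<Longrightarrow> 0 < n \<Longrightarrow> 0 < branch_mass n \<omega>"
  using b_pos by (cases n) (simp_all add: branch_mass_Suc ball_mass_pos baker_space)

lemma measure_m_ball_pos:
  assumes \<omega>: "\<omega> \<in> space P" and "0 < r"
  shows "0 < measure (m (fst \<omega>)) (ball (fibre_point \<omega>) r)"
proof -
  interpret finite_measure "m (fst \<omega>)" by (rule finite_measure_m)
  obtain n where "\<gamma> ^ n < r / S_radius"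
    using real_arch_pow_inv[of "r / S_radius" \<gamma>] \<open>0 < r\<close> S_radius_pos \<gamma> by auto
  then have "S_radius * \<gamma> ^ n \<le> r" using S_radius_pos by (simp add: field_simps)
  then have "ball_mass n \<omega> \<le> measure (m (fst \<omega>)) (ball (fibre_point \<omega>) r)"
    unfolding ball_mass_def by (intro finite_measure_mono subset_ball) auto
  then show ?thesis using ball_mass_pos[OF \<omega>, of n] by linarith
qed

lemma digit_info_nonneg: "\<omega> \<in> space P \<Longrightarrow> 0 \<le> digit_info n \<omega>"
  using branch_mass_pos[of \<omega> n] branch_mass_le_ball_mass[of n \<omega>] by (auto simp: digit_info_def)

lemma ln_ball_mass_eq:
  "\<omega> \<in> space P \<Longrightarrow> - ln (ball_mass n \<omega>) = n * ln b - (\<Sum>k<n. digit_info (n - k) ((baker ^^ k) \<omega>))"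
proof (induction n arbitrary: \<omega>)
  case (Suc n)
  have pos: "0 < ball_mass (Suc n) \<omega>" "0 < branch_mass (Suc n) \<omega>" "0 < ball_mass n (baker \<omega>)"
    using Suc.prems by (simp_all add: ball_mass_pos branch_mass_pos baker_space)
  have "digit_info (Suc n) \<omega> = ln (ball_mass (Suc n) \<omega>) - ln (branch_mass (Suc n) \<omega>)"
    using pos by (simp add: digit_info_def ln_div)
  moreover have "ln (branch_mass (Suc n) \<omega>) = ln (ball_mass n (baker \<omega>)) - ln b"
    unfolding branch_mass_Suc[OF Suc.prems] using pos(3) b_ge_2 by (simp add: ln_div)
  ultimately have "- ln (ball_mass (Suc n) \<omega>) = - ln (ball_mass n (baker \<omega>)) + ln b - digit_info (Suc n) \<omega>"
    by simp
  also have "- ln (ball_mass n (baker \<omega>)) = n * ln b - (\<Sum>k<n. digit_info (n - k) ((baker ^^ k) (baker \<omega>)))"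
    using Suc.IH[OF baker_space[OF Suc.prems]] .
  finally show ?case
    by (subst sum.lessThan_Suc_shift) (simp add: funpow_swap1 algebra_simps)
qed (simp add: ball_mass_0)

lemma ball_mass_measurable [measurable]: "ball_mass n \<in> borel_measurable P"
proof -
  let ?close = "\<lambda>z. dist (fibre_point (fst z)) (S (fst (fst z)) (snd z)) < S_radius * \<gamma> ^ n"
  have "(\<lambda>z. dist (fibre_point (fst z)) (S (fst (fst z)) (snd z))) \<in> borel_measurable (P \<Otimes>\<^sub>M D)"
    using measurable_compose[OF measurable_fst fibre_point_measurable]
      S_measurable[OF measurable_compose[OF measurable_fst fst_P_measurable] measurable_snd]
    by (intro borel_measurable_dist) auto
  then have "{z \<in> space (P \<Otimes>\<^sub>M D). ?close z} \<in> sets (P \<Otimes>\<^sub>M D)" by measurable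
  from D.measurable_emeasure_Pair[OF this]
  have "(\<lambda>\<omega>. measure D (Pair \<omega> -` {z \<in> space (P \<Otimes>\<^sub>M D). ?close z})) \<in> borel_measurable P"
    unfolding measure_def by measurable
  then show ?thesis
    by (rule measurable_cong[THEN iffD1, rotated])
       (auto simp: ball_mass_def measure_m space_pair_measure intro!: arg_cong[where f="measure D"])
qed

lemma branch_mass_Suc_measurable [measurable]: "branch_mass (Suc n) \<in> borel_measurable P"
proof -
  have "(\<lambda>\<omega>. ball_mass n (baker \<omega>) / b) \<in> borel_measurable P" by measurable
  then show ?thesis by (rule measurable_cong[THEN iffD1, rotated]) (simp add: branch_mass_Suc)
qed

lemma digit_info_measurable [measurable]: "digit_info n \<in> borel_measurable P"
proof (cases n)
  case (Suc k)
  have "(\<lambda>\<omega>. ln (ball_mass (Suc k) \<omega> / branch_mass (Suc k) \<omega>)) \<in> borel_measurable P" by measurable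
  with Suc show ?thesis by (simp add: digit_info_def[abs_def])
qed (simp add: digit_info_def[abs_def])

definition heavy_set :: "real \<Rightarrow> real \<Rightarrow> nat \<Rightarrow> real set" where
  "heavy_set t x i = maximal_set (branch_meas x i) (m x) (exp t) UNIV"

lemma measure_heavy_set_le: "measure (branch_meas x i) (heavy_set t x i) \<le> 2 * exp (- t)"
proof -
  interpret m: prob_space "m x" by (rule prob_space_m)
  have "exp t * measure (branch_meas x i) (heavy_set t x i) \<le> 2 * measure (m x) UNIV"
    unfolding heavy_set_def
    by (intro measure_maximal_set_le finite_measure_branch finite_measure_m) simp_all
  also have "measure (m x) UNIV = 1" using m.prob_space by simp
  finally show ?thesis by (simp add: exp_minus field_simps)
qed

lemma fibre_point_in_heavy_set:
  assumes \<omega>: "\<omega> \<in> space P" and "0 \<le> t" and less: "t < digit_info n \<omega>"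
  shows "fibre_point \<omega> \<in> heavy_set t (fst \<omega>) (snd \<omega> 0)"
proof -
  have "0 < n" using less \<open>0 \<le> t\<close> by (auto simp: digit_info_def intro: ccontr)
  then have pos: "0 < ball_mass n \<omega>" "0 < branch_mass n \<omega>" using ball_mass_pos branch_mass_pos \<omega> by auto
  then have "exp t \<le> ball_mass n \<omega> / branch_mass n \<omega>"
    using less \<open>0 < n\<close> by (subst ln_ge_iff[symmetric]) (auto simp: digit_info_def)
  then have "exp t * branch_mass n \<omega> \<le> ball_mass n \<omega>" using pos by (simp add: field_simps)
  then show ?thesis
    unfolding heavy_set_def ball_mass_def branch_mass_def
    by (rule maximal_setI) (use S_radius_pos \<gamma> in auto)
qed

lemma digit_info_tail_fibre:
  assumes "0 \<le> t"
  shows "emeasure D {j\<in>space D. \<exists>n. t < digit_info n (x, j)} \<le> ennreal (2 * real b * exp (- t))"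
proof -
  let ?E = "\<lambda>i. {j\<in>space D. j 0 = i \<and> S x j \<in> heavy_set t x i}"
  have heavy_borel: "heavy_set t x i \<in> sets borel" for i unfolding heavy_set_def by measurable
  have sets: "?E i \<in> sets D" for i
    by (intro sets.sets_Collect_conj sets_S_vimage heavy_borel) measurable
  have "{j\<in>space D. \<exists>n. t < digit_info n (x, j)} \<subseteq> (\<Union>i<b. ?E i)"
    using fibre_point_in_heavy_set[OF _ assms, of "(x, _)"] by (auto simp: space_P space_D)
  then have "emeasure D {j\<in>space D. \<exists>n. t < digit_info n (x, j)} \<le> emeasure D (\<Union>i<b. ?E i)"
    using sets by (intro emeasure_mono) auto
  also have "\<dots> \<le> (\<Sum>i<b. emeasure D (?E i))"
    using sets by (intro emeasure_subadditive_finite) auto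
  also have "\<dots> \<le> (\<Sum>i<b. ennreal (2 * exp (- t)))"
  proof (intro sum_mono)
    fix i
    have "emeasure D (?E i) = ennreal (measure (branch_meas x i) (heavy_set t x i))"
      by (simp add: emeasure_branch[OF heavy_borel, symmetric]
          finite_measure.emeasure_eq_measure[OF finite_measure_branch])
    also have "\<dots> \<le> ennreal (2 * exp (- t))" by (intro ennreal_leI measure_heavy_set_le)
    finally show "emeasure D (?E i) \<le> ennreal (2 * exp (- t))" .
  qed
  also have "\<dots> = ennreal (2 * real b * exp (- t))"
    by (simp add: ennreal_of_nat_eq_real_of_nat ennreal_mult''[symmetric] mult_ac)
  finally show ?thesis .
qed

lemma digit_info_tail:
  assumes "0 \<le> t"
  shows "emeasure P {\<omega>\<in>space P. \<exists>n. t < digit_info n \<omega>} \<le> ennreal (2 * real b * exp (- t))"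
proof -
  let ?X = "{\<omega>\<in>space P. \<exists>n. t < digit_info n \<omega>}"
  have X: "?X \<in> sets P" by measurable
  have "Pair x -` ?X = {j\<in>space D. \<exists>n. t < digit_info n (x, j)}" for x by (auto simp: space_P)
  then have "emeasure P ?X = (\<integral>\<^sup>+x. emeasure D {j\<in>space D. \<exists>n. t < digit_info n (x, j)} \<partial>\<U>)"
    by (simp only: D.emeasure_pair_measure_alt[OF X])
  also have "\<dots> \<le> (\<integral>\<^sup>+x. ennreal (2 * real b * exp (- t)) \<partial>\<U>)"
    by (intro nn_integral_mono digit_info_tail_fibre assms)
  also have "\<dots> = ennreal (2 * real b * exp (- t))" using U.emeasure_space_1 by simp
  finally show ?thesis .
qed

lemma digit_info_majorant:
  obtains G where "integrable P G" "AE \<omega> in P. \<forall>n. \<bar>digit_info n \<omega>\<bar> \<le> G \<omega>"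
proof (rule integrable_majorant_if_summable_tails[of digit_info P])
  have "(\<Sum>k. emeasure P {\<omega>\<in>space P. \<exists>n. real k < digit_info n \<omega>})
      \<le> (\<Sum>k. ennreal (2 * real b * exp (- real k)))"
    by (intro suminf_le digit_info_tail) auto
  also have "summable (\<lambda>k. 2 * real b * exp (-1) ^ k)" by (intro summable_mult summable_geometric) simp
  then have "summable (\<lambda>k. 2 * real b * exp (- real k))" by (simp add: exp_of_nat_mult[symmetric])
  then have "(\<Sum>k. ennreal (2 * real b * exp (- real k))) = ennreal (\<Sum>k. 2 * real b * exp (- real k))"
    by (intro suminf_ennreal2) auto
  also have "\<dots> < \<infinity>" by simp
  finally show "(\<Sum>k. emeasure P {\<omega>\<in>space P. \<exists>n. real k < digit_info n \<omega>}) < \<infinity>" .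
qed (use digit_info_nonneg that in auto)

lemma mass_ratio_convergent: "AE \<omega> in P. convergent (\<lambda>n. branch_mass (Suc n) \<omega> / ball_mass (Suc n) \<omega>)"
proof (rule UD.AE_pair_measure)
  have "(\<lambda>\<omega>. branch_mass (Suc n) \<omega> / ball_mass (Suc n) \<omega>) \<in> borel_measurable P" for n by measurable
  then show "{\<omega>\<in>space P. convergent (\<lambda>n. branch_mass (Suc n) \<omega> / ball_mass (Suc n) \<omega>)} \<in> sets P"
    unfolding Cauchy_convergent_iff[symmetric] by (rule sets_Collect_Cauchy)
  have radii: "filterlim (\<lambda>n. S_radius * \<gamma> ^ Suc n) (at_right 0) sequentially"
    by (rule filterlim_compose[OF powers_at_right_0[OF S_radius_pos \<gamma>] filterlim_Suc])
  have "AE j in D. convergent (\<lambda>n. branch_mass (Suc n) (x, j) / ball_mass (Suc n) (x, j))" for x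
  proof -
    have "AE y in m x. \<forall>i. ((\<lambda>s. measure (branch_meas x i) (ball y s) / measure (m x) (ball y s))
        \<longlongrightarrow> enn2real (RN_deriv (m x) (branch_meas x i) y)) (at_right 0)"
      unfolding AE_all_countable
      by (intro allI ball_ratio_tendsto_RN_deriv finite_measure_m finite_measure_branch
          absolutely_continuous_branch) simp_all
    then have "AE y in distr D borel (S x). \<forall>i.
        ((\<lambda>s. measure (branch_meas x i) (ball y s) / measure (m x) (ball y s))
        \<longlongrightarrow> enn2real (RN_deriv (m x) (branch_meas x i) y)) (at_right 0)"
      unfolding m_meas_def .
    from AE_distrD[OF Sx_measurable this] show ?thesis
    proof eventually_elim
      case (elim j)
      from filterlim_compose[OF elim[rule_format, of "j 0"] radii] show ?case
        unfolding branch_mass_def ball_mass_def fst_conv snd_conv by (rule convergentI)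
    qed
  qed
  then show "AE x in \<U>. AE j in D. convergent (\<lambda>n. branch_mass (Suc n) (x, j) / ball_mass (Suc n) (x, j))"
    by simp
qed

lemma digit_info_convergent: "AE \<omega> in P. convergent (\<lambda>n. digit_info n \<omega>)"
proof -
  obtain G where "integrable P G" and G: "AE \<omega> in P. \<forall>n. \<bar>digit_info n \<omega>\<bar> \<le> G \<omega>"
    by (rule digit_info_majorant)
  show ?thesis using G mass_ratio_convergent AE_space
  proof eventually_elim
    case (elim \<omega>)
    let ?ratio = "\<lambda>n. branch_mass (Suc n) \<omega> / ball_mass (Suc n) \<omega>"
    obtain l where l: "?ratio \<longlonglongrightarrow> l" using elim(2) by (auto simp: convergent_def)
    have info: "exp (- digit_info (Suc n) \<omega>) = ?ratio n" for n
      using ball_mass_pos[OF elim(3), of "Suc n"] branch_mass_pos[OF elim(3), of "Suc n"]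
      by (simp add: digit_info_def exp_minus)
    have "exp (- G \<omega>) \<le> ?ratio n" for n
      unfolding info[symmetric] using elim(1)[rule_format, of "Suc n"] by simp
    then have "exp (- G \<omega>) \<le> l" by (intro LIMSEQ_le_const[OF l]) blast
    then have "0 < l" using exp_gt_zero[of "- G \<omega>"] by linarith
    then have "(\<lambda>n. - ln (?ratio n)) \<longlonglongrightarrow> - ln l" by (intro tendsto_intros l) simp
    then have "(\<lambda>n. digit_info (Suc n) \<omega>) \<longlonglongrightarrow> - ln l" by (simp flip: info)
    then show ?case by (intro convergentI) (rule LIMSEQ_imp_Suc)
  qed
qed

definition fibre_dim :: real where
  "fibre_dim = (ln b - (\<integral>\<omega>. lim (\<lambda>n. digit_info n \<omega>) \<partial>P)) / (- ln \<gamma>)"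

lemma AE_has_exponent_m:
  "AE \<omega> in P. has_exponent (\<lambda>r. measure (m (fst \<omega>)) (ball (fibre_point \<omega>) r)) fibre_dim"
proof -
  define h where "h = (\<integral>\<omega>. lim (\<lambda>n. digit_info n \<omega>) \<partial>P)"
  obtain G where G: "integrable P G" "AE \<omega> in P. \<forall>n. \<bar>digit_info n \<omega>\<bar> \<le> G \<omega>" by (rule digit_info_majorant)
  have "AE \<omega> in P. (\<lambda>n. digit_info n \<omega>) \<longlonglongrightarrow> lim (\<lambda>n. digit_info n \<omega>)"
    using digit_info_convergent by (simp add: convergent_LIMSEQ_iff)
  then have "AE \<omega> in P. (\<lambda>n. (\<Sum>k<n. digit_info (n - k) ((baker ^^ k) \<omega>)) / n) \<longlonglongrightarrow> h"
    unfolding h_def using G by (intro baker.maker_ergodic) auto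
  then show ?thesis using AE_space
  proof eventually_elim
    case (elim \<omega>)
    interpret m: finite_measure "m (fst \<omega>)" by (rule finite_measure_m)
    have "(\<lambda>n. ln b - (\<Sum>k<n. digit_info (n - k) ((baker ^^ k) \<omega>)) / n) \<longlonglongrightarrow> ln b - h"
      by (intro tendsto_intros elim)
    moreover have "\<forall>\<^sub>F n in sequentially. ln b - (\<Sum>k<n. digit_info (n - k) ((baker ^^ k) \<omega>)) / n
        = - ln (ball_mass n \<omega>) / n"
      using eventually_gt_at_top[of 0]
      by eventually_elim (simp add: ln_ball_mass_eq[OF elim(2)] diff_divide_distrib)
    ultimately have "(\<lambda>n. - ln (ball_mass n \<omega>) / n) \<longlonglongrightarrow> ln b - h" by (rule Lim_transform_eventually)
    then show ?case
      unfolding fibre_dim_def h_def[symmetric] ball_mass_def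
      by (intro has_exponent_if_along_powers[OF _ _ S_radius_pos \<gamma>])
         (auto intro!: measure_m_ball_pos elim m.finite_measure_mono)
  qed
qed

lemma AE_exact_dimensional_m: "AE x in \<U>. exact_dimensional (m x) fibre_dim"
  using UD.AE_pair[OF AE_has_exponent_m]
proof eventually_elim
  case (elim x)
  then show ?case unfolding m_meas_def
    by (intro exact_dimensional_distrI D.prob_space_axioms Sx_measurable) simp
qed

lemma AE_lborel_exact_dimensional_m: "AE x in lborel. x \<in> {0..1} \<longrightarrow> exact_dimensional (m x) fibre_dim"
proof -
  have "AE x in lborel. x \<in> {0..<1} \<longrightarrow> exact_dimensional (m x) fibre_dim"
    using AE_exact_dimensional_m by (subst (asm) AE_uniform_measure) auto
  moreover have "AE x in lborel. x \<noteq> (1::real)" by (rule AE_lborel_singleton)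
  ultimately show ?thesis by eventually_elim auto
qed

lemma fibre_dim_in_unit_interval: "fibre_dim \<in> {0..1}"
proof -
  have "AE x in \<U>. fibre_dim \<in> {0..1}"
    using AE_exact_dimensional_m
  proof eventually_elim
    case (elim x)
    then show ?case
      using exact_dimensional_nonneg[OF prob_space_m] exact_dimensional_real_le_1[OF prob_space_m] by auto
  qed
  then show ?thesis by simp
qed

subsection \<open>Local dimension of the SRB measure\<close>

abbreviation srb :: "(real \<times> real) measure" where "srb \<equiv> omega_meas b \<gamma> \<phi>"
abbreviation graph :: "real \<times> (nat \<Rightarrow> nat) \<Rightarrow> real \<times> real" where "graph \<omega> \<equiv> (fst \<omega>, fibre_point \<omega>)"

lemma graph_measurable: "graph \<in> borel_measurable P"
  by (intro borel_measurable_Pair fst_P_measurable fibre_point_measurable)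

lemma Pair_vimage_borel: "A \<in> sets borel \<Longrightarrow> Pair x -` A \<in> sets borel" for A :: "(real \<times> real) set"
  using sets_Pair1[of A borel borel x] by (simp only: borel_prod)

lemma
  assumes A: "A \<in> sets borel"
  shows emeasure_distr_graph: "emeasure (distr P borel graph) A = (\<integral>\<^sup>+x. emeasure (m x) (Pair x -` A) \<partial>\<U>)"
    and borel_measurable_emeasure_m_Pair: "(\<lambda>x. emeasure (m x) (Pair x -` A)) \<in> borel_measurable borel"
proof -
  let ?X = "graph -` A \<inter> space P"
  have X: "?X \<in> sets P" by (rule measurable_sets[OF graph_measurable A])
  have "Pair x -` ?X = {j\<in>space D. S x j \<in> Pair x -` A}" for x by (auto simp: space_P)
  then have slice: "emeasure D (Pair x -` ?X) = emeasure (m x) (Pair x -` A)" for x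
    by (simp only: emeasure_m[OF Pair_vimage_borel[OF A]])
  have "emeasure (distr P borel graph) A = emeasure P ?X" by (rule emeasure_distr[OF graph_measurable A])
  then show "emeasure (distr P borel graph) A = (\<integral>\<^sup>+x. emeasure (m x) (Pair x -` A) \<partial>\<U>)"
    by (simp only: D.emeasure_pair_measure_alt[OF X] slice)
  have "(\<lambda>x. emeasure D (Pair x -` ?X)) \<in> borel_measurable \<U>" by (rule D.measurable_emeasure_Pair[OF X])
  then show "(\<lambda>x. emeasure (m x) (Pair x -` A)) \<in> borel_measurable borel"
    unfolding slice by (simp add: measurable_cong_sets[OF sets_uniform_measure refl] measurable_lborel1)
qed

lemma srb_eq_distr_graph: "srb = distr P borel graph"
proof -
  let ?W = "distr P borel graph"
  have "srb = measure_of UNIV (sets borel) (emeasure ?W)"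
    unfolding omega_meas_def
  proof (rule measure_of_eq)
    fix A :: "(real \<times> real) set" assume "A \<in> sigma_sets UNIV (sets borel)"
    then have A: "A \<in> sets borel" using sets.sigma_sets_eq[of "borel :: (real \<times> real) measure"] by simp
    have "emeasure ?W A
        = (\<integral>\<^sup>+x. emeasure (m x) (Pair x -` A) * indicator {0..<1} x \<partial>lborel) / emeasure lborel {0..<1::real}"
      unfolding emeasure_distr_graph[OF A] using borel_measurable_emeasure_m_Pair[OF A]
      by (intro nn_integral_uniform_measure) auto
    then show "(\<integral>\<^sup>+x. indicator {0..<1} x * emeasure (m x) (Pair x -` A) \<partial>lborel) = emeasure ?W A"
      by (simp add: divide_ennreal_def mult.commute)
  qed simp
  also have "\<dots> = measure_of (space ?W) (sets ?W) (emeasure ?W)" by simp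
  also have "\<dots> = ?W" by (rule measure_of_of_measure)
  finally show ?thesis .
qed

lemma emeasure_srb: "A \<in> sets borel \<Longrightarrow> emeasure srb A = (\<integral>\<^sup>+x. emeasure (m x) (Pair x -` A) \<partial>\<U>)"
  by (simp only: srb_eq_distr_graph emeasure_distr_graph)

lemma prob_space_srb: "prob_space srb"
  unfolding srb_eq_distr_graph by (rule UD.prob_space_distr[OF graph_measurable])

lemma emeasure_m_ball_le:
  assumes "r + S_lip * \<bar>x - x'\<bar> \<le> s"
  shows "emeasure (m x) (ball y r) \<le> emeasure (m x') (ball y s)"
proof -
  have "S x' j \<in> ball y s" if "S x j \<in> ball y r" for j
    using that S_lipschitz[of x j x'] assms by (simp add: dist_real_def)
  then have "emeasure D {j\<in>space D. S x j \<in> ball y r} \<le> emeasure D {j\<in>space D. S x' j \<in> ball y s}"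
    by (intro emeasure_mono sets_S_vimage) (auto simp del: mem_ball)
  then show ?thesis by (simp only: emeasure_m borel_open open_ball)
qed

lemma measure_srb_ball_upper:
  assumes "0 < r"
  shows "measure srb (ball (x, y) r) \<le> 2 * r * measure (m x) (ball y ((1 + S_lip) * r))"
proof -
  interpret srb: prob_space srb by (rule prob_space_srb)
  define c where "c = measure (m x) (ball y ((1 + S_lip) * r))"
  have emeasure_eq_c: "emeasure (m x) (ball y ((1 + S_lip) * r)) = ennreal c"
    unfolding c_def by (rule finite_measure.emeasure_eq_measure[OF finite_measure_m])
  have slice: "emeasure (m x') (Pair x' -` ball (x, y) r) \<le> ennreal c * indicator (ball x r) x'" for x'
  proof (cases "x' \<in> ball x r")
    case True
    then have "Pair x' -` ball (x, y) r \<subseteq> ball y r" using Pair_vimage_ball_subset[of x' x y r] by simp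
    then have "emeasure (m x') (Pair x' -` ball (x, y) r) \<le> emeasure (m x') (ball y r)"
      by (intro emeasure_mono) auto
    also have "S_lip * \<bar>x' - x\<bar> \<le> S_lip * r"
      using True S_lip_nonneg by (intro mult_left_mono) (auto simp: dist_real_def)
    then have "emeasure (m x') (ball y r) \<le> ennreal c"
      unfolding emeasure_eq_c[symmetric] by (intro emeasure_m_ball_le) (simp add: algebra_simps)
    finally show ?thesis using True by simp
  next
    case False
    then have "Pair x' -` ball (x, y) r = {}" using Pair_vimage_ball_subset[of x' x y r] by simp
    then show ?thesis by simp
  qed
  have "emeasure srb (ball (x, y) r) = (\<integral>\<^sup>+x'. emeasure (m x') (Pair x' -` ball (x, y) r) \<partial>\<U>)"
    by (rule emeasure_srb) simp
  also have "\<dots> \<le> (\<integral>\<^sup>+x'. ennreal c * indicator (ball x r) x' \<partial>\<U>)" by (intro nn_integral_mono slice)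
  also have "\<dots> = ennreal c * emeasure \<U> (ball x r)" by (rule nn_integral_cmult_indicator) simp
  also have "emeasure \<U> (ball x r) \<le> emeasure lborel (ball x r)"
    by (subst emeasure_U) (auto intro!: emeasure_mono)
  then have "ennreal c * emeasure \<U> (ball x r) \<le> ennreal c * ennreal (2 * r)"
    using assms by (intro mult_left_mono) (simp_all add: ball_eq_greaterThanLessThan)
  also have "\<dots> = ennreal (2 * r * c)"
    using assms by (subst ennreal_mult''[symmetric]) (simp_all add: mult.commute)
  finally show ?thesis using assms by (simp add: srb.emeasure_eq_measure c_def)
qed

lemma measure_srb_ball_lower:
  assumes "0 < r" "0 \<le> x" "x + r / (4 * (1 + S_lip)) \<le> 1"
  shows "r / (4 * (1 + S_lip)) * measure (m x) (ball y (1 / 4 * r)) \<le> measure srb (ball (x, y) r)"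
proof -
  interpret srb: prob_space srb by (rule prob_space_srb)
  define c where "c = measure (m x) (ball y (1 / 4 * r))"
  have emeasure_eq_c: "emeasure (m x) (ball y (1 / 4 * r)) = ennreal c"
    unfolding c_def by (rule finite_measure.emeasure_eq_measure[OF finite_measure_m])
  define d where "d = r / (4 * (1 + S_lip))"
  have "M * (r / (4 * M)) = r / 4" if "M > 0" for M :: real using that by simp
  from this[of "1 + S_lip"] have "(1 + S_lip) * d = r / 4" "0 < d"
    using S_lip_nonneg assms(1) by (auto simp: d_def)
  then have "0 < d" and d_sum: "d + S_lip * d = r / 4" by (simp_all add: distrib_right)
  then have d_le: "d \<le> r / 4" using \<open>0 < d\<close> S_lip_nonneg mult_nonneg_nonneg[of S_lip d] by linarith
  have slice: "ennreal c * indicator {x..<x + d} x' \<le> emeasure (m x') (Pair x' -` ball (x, y) r)" for x'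
  proof (cases "x' \<in> {x..<x + d}")
    case True
    have "S_lip * \<bar>x - x'\<bar> \<le> S_lip * d" using True S_lip_nonneg by (intro mult_left_mono) auto
    then have "ennreal c \<le> emeasure (m x') (ball y (r / 2))"
      unfolding emeasure_eq_c[symmetric] using \<open>0 < d\<close> d_sum by (intro emeasure_m_ball_le) linarith
    also have "ball y (r / 2) \<subseteq> Pair x' -` ball (x, y) r"
      using True d_le assms(1) by (intro ball_subset_Pair_vimage_ball) (simp add: dist_real_def)
    then have "emeasure (m x') (ball y (r / 2)) \<le> emeasure (m x') (Pair x' -` ball (x, y) r)"
      using Pair_vimage_borel[of "ball (x, y) r" x'] by (intro emeasure_mono) simp_all
    finally show ?thesis using True by simp
  qed simp
  have "ennreal c * emeasure \<U> {x..<x + d} = (\<integral>\<^sup>+x'. ennreal c * indicator {x..<x + d} x' \<partial>\<U>)"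
    by (rule nn_integral_cmult_indicator[symmetric]) simp
  also have "\<dots> \<le> (\<integral>\<^sup>+x'. emeasure (m x') (Pair x' -` ball (x, y) r) \<partial>\<U>)" by (intro nn_integral_mono slice)
  also have "\<dots> = emeasure srb (ball (x, y) r)" by (rule emeasure_srb[symmetric]) simp
  also have "emeasure \<U> {x..<x + d} = ennreal d"
  proof -
    have "{0..<1} \<inter> {x..<x + d} = {x..<x + d}" using assms by (auto simp: d_def)
    then show ?thesis using \<open>0 < d\<close> by (subst emeasure_U) auto
  qed
  finally have "ennreal (d * c) \<le> emeasure srb (ball (x, y) r)"
    using \<open>0 < d\<close> by (simp add: ennreal_mult'' mult.commute c_def)
  then show ?thesis by (simp add: srb.emeasure_eq_measure c_def d_def)
qed

lemma has_exponent_srb: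
  assumes x: "0 \<le> x" "x < 1"
    and pos: "\<And>r. 0 < r \<Longrightarrow> 0 < measure (m x) (ball y r)"
    and exponent: "has_exponent (\<lambda>r. measure (m x) (ball y r)) \<alpha>"
  shows "has_exponent (\<lambda>r. measure srb (ball (x, y) r)) (1 + \<alpha>)"
proof (rule has_exponent_sandwich)
  let ?a = "\<lambda>r. measure (m x) (ball y r)" and ?M = "4 * (1 + S_lip)"
  have M_pos: "0 < ?M" using S_lip_nonneg by simp
  have "has_exponent (\<lambda>r. 1 / ?M * r * ?a (1 / 4 * r)) (1 + \<alpha>)"
    using M_pos by (intro has_exponent_mult has_exponent_linear has_exponent_rescale[OF exponent] pos) auto
  then show "has_exponent (\<lambda>r. r / ?M * ?a (1 / 4 * r)) (1 + \<alpha>)" by simp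
  show "has_exponent (\<lambda>r. 2 * r * ?a ((1 + S_lip) * r)) (1 + \<alpha>)"
    using S_lip_nonneg
    by (intro has_exponent_mult has_exponent_linear has_exponent_rescale[OF exponent] pos) auto
  have "0 < ?M * (1 - x)" using M_pos x by simp
  then have "\<forall>\<^sub>F r in at_right 0. r \<in> {0<..<?M * (1 - x)}" by (rule eventually_at_right_real)
  then show "\<forall>\<^sub>F r in at_right 0. 0 < r / ?M * ?a (1 / 4 * r)
      \<and> r / ?M * ?a (1 / 4 * r) \<le> measure srb (ball (x, y) r)
      \<and> measure srb (ball (x, y) r) \<le> 2 * r * ?a ((1 + S_lip) * r)"
  proof eventually_elim
    case (elim r)
    then have "r / ?M < 1 - x" using M_pos by (simp add: pos_divide_less_eq mult.commute)
    then show ?case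
      using elim M_pos x pos[of "1 / 4 * r"]
      by (intro conjI mult_pos_pos divide_pos_pos measure_srb_ball_lower measure_srb_ball_upper) auto
  qed
qed

lemma exact_dimensional_srb: "exact_dimensional srb (1 + fibre_dim)"
proof -
  have "AE \<omega> in P. has_exponent (\<lambda>r. measure srb (ball (graph \<omega>) r)) (1 + fibre_dim)"
    using AE_has_exponent_m AE_fst_unit AE_space
  proof eventually_elim
    case (elim \<omega>)
    then show ?case by (intro has_exponent_srb measure_m_ball_pos) auto
  qed
  then show ?thesis
    unfolding srb_eq_distr_graph by (intro exact_dimensional_distrI UD.prob_space_axioms graph_measurable)
qed

end

theorem theorem3p1:
  fixes b :: nat and \<gamma> :: real and \<phi> :: "real \<Rightarrow> real"
  assumes "b \<ge> 2"
    and "0 < \<gamma>" and "\<gamma> < 1"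
    and "\<And>x. \<phi> (x + 1) = \<phi> x"
    and "\<exists>C. C-lipschitz_on UNIV \<phi>"
  shows "(\<exists>\<beta>. exact_dimensional (omega_meas b \<gamma> \<phi>) \<beta>) \<and>
         (\<exists>\<alpha>\<in>{0..1}.
           (AE x in lborel. x \<in> {0..1} \<longrightarrow> exact_dimensional (m_meas b \<gamma> \<phi> x) \<alpha>)
         \<and> exact_dimensional (omega_meas b \<gamma> \<phi>) (1 + \<alpha>))"
proof -
  from assms(5) obtain C where "C-lipschitz_on UNIV \<phi>" ..
  with assms(1-4) interpret skew_product b \<gamma> \<phi> C by unfold_locales
  show ?thesis
    using exact_dimensional_srb AE_lborel_exact_dimensional_m fibre_dim_in_unit_interval by blast
qed

end
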